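(* Let $n\geq 1$ be an integer and let $R$ be an integral domain which is a free $\mathbb Z$-algebra of rank $2$ (i.e. an order in a quadratic field) of discriminant $d$. A primitive binary quadratic form $q=ax^2+bxy+cy^2\in\mathbb Z[x,y]$ of discriminant $d$ corresponds to an element of the subgroup $\mathrm{cl}(R)[n]\subset \mathrm{cl}(R)$ if and only if there exists a binary form $\varphi=\sum_{i=0}^n t_ix^iy^{n-i}\in\mathbb Z[x,y]$ of degree $n$ such that the resultant $\operatorname{res}(q,\varphi)$ is $1$ or $-1$.
   Context: $\mathrm{cl}(R)$ denotes the class group of $R$ (invertible fractional ideals modulo principal ones), and $\mathrm{cl}(R)[n]$ its $n$-torsion subgroup. The correspondence between primitive quadratic forms of discriminant $d$ and ideal classes of $R$ is the classical one: a form $q$ corresponds to the class of an invertible ideal $I_q=\langle\alpha,\beta\rangle$ of $R$ for which $q(x,y)=\mathrm{N}_{R/\mathbb Z}(-\beta x+\alpha y)/\mathrm{N}_{R/\mathbb Z}(\langle\alpha,\beta\rangle)$. The discriminant of $ax^2+bxy+cy^2$ is $b^2-4ac$; primitive means $\gcd(a,b,c)=1$.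
   Formalization: For negative definite q no ideal satisfies the stated norm formula with positive ideal norm (e.g. −x²−y², n=1, φ=x), so q is assigned the ideal classes of −q (ideal norm signed by orientation); for all other forms the formula is literal. *)

theory Defs
  imports
    "HOL-Algebra.Coset"
    "HOL-Computational_Algebra.Polynomial_Factorial"
    "Subresultants.Resultant_Prelim"
begin

section \<open>Free \<open>\<int>\<close>-algebras of rank 2: norm, trace, discriminant\<close>

definition int_basis :: "'a::comm_ring_1 \<Rightarrow> 'a \<Rightarrow> bool" where
  "int_basis \<omega>\<^sub>1 \<omega>\<^sub>2 \<longleftrightarrow>
     (\<forall>x. \<exists>!p :: int \<times> int. x = of_int (fst p) * \<omega>\<^sub>1 + of_int (snd p) * \<omega>\<^sub>2)"

definition int_coords :: "'a::comm_ring_1 \<Rightarrow> 'a \<Rightarrow> 'a \<Rightarrow> int \<times> int" where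
  "int_coords \<omega>\<^sub>1 \<omega>\<^sub>2 x = (THE p. x = of_int (fst p) * \<omega>\<^sub>1 + of_int (snd p) * \<omega>\<^sub>2)"

text \<open>Norm and trace are the determinant and the trace of the \<open>2 \<times> 2\<close> integer matrix of
  multiplication by \<open>x\<close>; their values, and that of the discriminant
  \<open>det (Tr (\<omega>\<^sub>i \<omega>\<^sub>j))\<close>, do not depend on the basis.\<close>

definition norm_int :: "'a::comm_ring_1 \<Rightarrow> 'a \<Rightarrow> 'a \<Rightarrow> int" where
  "norm_int \<omega>\<^sub>1 \<omega>\<^sub>2 x =
     (let (p, q) = int_coords \<omega>\<^sub>1 \<omega>\<^sub>2 (x * \<omega>\<^sub>1);
          (r, s) = int_coords \<omega>\<^sub>1 \<omega>\<^sub>2 (x * \<omega>\<^sub>2)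
      in p * s - q * r)"

definition trace_int :: "'a::comm_ring_1 \<Rightarrow> 'a \<Rightarrow> 'a \<Rightarrow> int" where
  "trace_int \<omega>\<^sub>1 \<omega>\<^sub>2 x =
     fst (int_coords \<omega>\<^sub>1 \<omega>\<^sub>2 (x * \<omega>\<^sub>1)) + snd (int_coords \<omega>\<^sub>1 \<omega>\<^sub>2 (x * \<omega>\<^sub>2))"

definition discriminant :: "'a::comm_ring_1 \<Rightarrow> 'a \<Rightarrow> int" where
  "discriminant \<omega>\<^sub>1 \<omega>\<^sub>2 =
     trace_int \<omega>\<^sub>1 \<omega>\<^sub>2 (\<omega>\<^sub>1 * \<omega>\<^sub>1) * trace_int \<omega>\<^sub>1 \<omega>\<^sub>2 (\<omega>\<^sub>2 * \<omega>\<^sub>2)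
     - trace_int \<omega>\<^sub>1 \<omega>\<^sub>2 (\<omega>\<^sub>1 * \<omega>\<^sub>2) * trace_int \<omega>\<^sub>1 \<omega>\<^sub>2 (\<omega>\<^sub>2 * \<omega>\<^sub>1)"

section \<open>The class group of an integral domain\<close>

text \<open>The ring \<open>R\<close> is the whole type \<open>'a\<close>, its field of fractions is the type \<open>'a fract\<close>, and
  \<open>range to_fract\<close> is \<open>R\<close> inside its field of fractions.\<close>

definition frac_scale :: "'a::idom \<Rightarrow> 'a fract \<Rightarrow> 'a fract" where
  "frac_scale r x = to_fract r * x"

interpretation frac_mod: Modules.module "frac_scale :: 'a::idom \<Rightarrow> 'a fract \<Rightarrow> 'a fract"
  by unfold_locales (simp_all add: frac_scale_def algebra_simps)

definition fractional_ideal :: "'a::idom fract set \<Rightarrow> bool" where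
  "fractional_ideal I \<longleftrightarrow>
     frac_mod.subspace I \<and> (\<exists>r. r \<noteq> 0 \<and> frac_scale r ` I \<subseteq> range to_fract)"

definition ideal_mult :: "'a::idom fract set \<Rightarrow> 'a fract set \<Rightarrow> 'a fract set" where
  "ideal_mult I J = frac_mod.span {x * y | x y. x \<in> I \<and> y \<in> J}"

definition invertible_ideal :: "'a::idom fract set \<Rightarrow> bool" where
  "invertible_ideal I \<longleftrightarrow>
     fractional_ideal I \<and> (\<exists>J. fractional_ideal J \<and> ideal_mult I J = range to_fract)"

definition invertible_ideal_group :: "'a::idom fract set monoid" where
  "invertible_ideal_group =
     \<lparr>carrier = Collect invertible_ideal, monoid.mult = ideal_mult, monoid.one = range to_fract\<rparr>"

definition principal_ideals :: "'a::idom fract set set" where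
  "principal_ideals = {frac_mod.span {x} | x. x \<noteq> 0}"

lemma span_mult_mem:
  assumes "x \<in> frac_mod.span A" "y \<in> frac_mod.span B"
  shows "x * y \<in> frac_mod.span {x * y | x y. x \<in> A \<and> y \<in> B}"
proof -
  let ?P = "frac_mod.span {x * y | x y. x \<in> A \<and> y \<in> B}"
  have A: "x * b \<in> ?P" if "b \<in> B" for b
    using assms(1)
  proof (induction rule: frac_mod.span_induct_alt)
    case base
    show ?case by (simp add: frac_mod.span_zero)
  next
    case (step r a z)
    have "a * b \<in> ?P" using step that by (intro frac_mod.span_base) blast
    hence "frac_scale r (a * b) + z * b \<in> ?P"
      using step by (intro frac_mod.span_add frac_mod.span_scale)
    moreover have "frac_scale r (a * b) + z * b = (frac_scale r a + z) * b"
      by (simp add: frac_scale_def algebra_simps)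
    ultimately show ?case by simp
  qed
  show ?thesis
    using assms(2)
  proof (induction rule: frac_mod.span_induct_alt)
    case base
    show ?case by (simp add: frac_mod.span_zero)
  next
    case (step r b z)
    have "frac_scale r (x * b) + x * z \<in> ?P"
      using step A by (intro frac_mod.span_add frac_mod.span_scale)
    moreover have "frac_scale r (x * b) + x * z = x * (frac_scale r b + z)"
      by (simp add: frac_scale_def algebra_simps)
    ultimately show ?case by simp
  qed
qed

lemma ideal_mult_span:
  "ideal_mult (frac_mod.span A) (frac_mod.span B) = frac_mod.span {x * y | x y. x \<in> A \<and> y \<in> B}"
  unfolding ideal_mult_def
proof (rule antisym)
  show "frac_mod.span {x * y | x y. x \<in> frac_mod.span A \<and> y \<in> frac_mod.span B}
      \<subseteq> frac_mod.span {x * y | x y. x \<in> A \<and> y \<in> B}"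
    by (rule frac_mod.span_minimal) (auto intro: span_mult_mem)
  show "frac_mod.span {x * y | x y. x \<in> A \<and> y \<in> B}
      \<subseteq> frac_mod.span {x * y | x y. x \<in> frac_mod.span A \<and> y \<in> frac_mod.span B}"
    by (rule frac_mod.span_mono) (blast intro: frac_mod.span_base)
qed

lemma ideal_mult_commute:
  fixes I J :: "'a::idom fract set"
  shows "ideal_mult I J = ideal_mult J I"
proof -
  have "{x * y | x y. x \<in> I \<and> y \<in> J} \<subseteq> {x * y | x y. x \<in> J \<and> y \<in> I}" for I J :: "'a fract set"
    by clarify (metis mult.commute)
  hence "{x * y | x y. x \<in> I \<and> y \<in> J} = {x * y | x y. x \<in> J \<and> y \<in> I}"
    by (intro antisym)
  thus ?thesis by (simp only: ideal_mult_def)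
qed

lemma ideal_mult_assoc:
  assumes "frac_mod.subspace I" "frac_mod.subspace J" "frac_mod.subspace K"
  shows "ideal_mult (ideal_mult I J) K = ideal_mult I (ideal_mult J K)"
proof -
  have s: "frac_mod.span I = I" "frac_mod.span J = J" "frac_mod.span K = K"
    using assms by (simp_all add: frac_mod.span_eq_iff)
  have 1: "ideal_mult (ideal_mult I J) K
    = frac_mod.span {x * y | x y. x \<in> {x * y | x y. x \<in> I \<and> y \<in> J} \<and> y \<in> K}"
    using ideal_mult_span[of "{x * y | x y. x \<in> I \<and> y \<in> J}" K] by (simp add: s ideal_mult_def)
  have 2: "ideal_mult I (ideal_mult J K)
    = frac_mod.span {x * y | x y. x \<in> I \<and> y \<in> {x * y | x y. x \<in> J \<and> y \<in> K}}"
    using ideal_mult_span[of I "{x * y | x y. x \<in> J \<and> y \<in> K}"] by (simp add: s ideal_mult_def)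
  have "{x * y | x y. x \<in> {x * y | x y. x \<in> I \<and> y \<in> J} \<and> y \<in> K}
    = {x * y | x y. x \<in> I \<and> y \<in> {x * y | x y. x \<in> J \<and> y \<in> K}}" (is "?L = ?R")
  proof (intro antisym subsetI)
    fix u assume "u \<in> ?L"
    then obtain x y z where "u = (x * y) * z" "x \<in> I" "y \<in> J" "z \<in> K" by blast
    thus "u \<in> ?R" unfolding mult.assoc by blast
  next
    fix u assume "u \<in> ?R"
    then obtain x y z where "u = x * (y * z)" "x \<in> I" "y \<in> J" "z \<in> K" by blast
    thus "u \<in> ?L" unfolding mult.assoc[symmetric] by blast
  qed
  thus ?thesis unfolding 1 2 by (simp only:)
qed

lemma range_to_fract: "range to_fract = frac_mod.span {1}"
  by (auto simp: frac_mod.span_singleton frac_scale_def)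

lemma ideal_mult_one:
  assumes "frac_mod.subspace I"
  shows "ideal_mult (range to_fract) I = I"
proof -
  have "ideal_mult (frac_mod.span {1}) (frac_mod.span I) = frac_mod.span I"
    unfolding ideal_mult_span by simp
  thus ?thesis using assms by (simp add: range_to_fract frac_mod.span_eq_iff[THEN iffD2])
qed

lemma fractional_ideal_mult:
  assumes "fractional_ideal I" "fractional_ideal J"
  shows "fractional_ideal (ideal_mult I J)"
proof -
  obtain r s where r: "r \<noteq> 0" "frac_scale r ` I \<subseteq> range to_fract"
    and s: "s \<noteq> 0" "frac_scale s ` J \<subseteq> range to_fract"
    using assms by (auto simp: fractional_ideal_def)
  have "frac_scale (r * s) x \<in> range to_fract" if "x \<in> ideal_mult I J" for x
    using that unfolding ideal_mult_def
  proof (induction rule: frac_mod.span_induct_alt)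
    case base
    show ?case by (metis frac_mod.scale_zero_right rangeI to_fract_0)
  next
    case (step t a z)
    then obtain i j where a: "a = i * j" "i \<in> I" "j \<in> J" by blast
    obtain u v where uv: "frac_scale r i = to_fract u" "frac_scale s j = to_fract v"
      using a r s by (meson image_subset_iff rangeE)
    have "frac_scale (r * s) a = to_fract (u * v)"
      by (simp add: a(1) frac_scale_def flip: uv)
    moreover obtain w where "frac_scale (r * s) z = to_fract w" using step by blast
    ultimately have "frac_scale (r * s) (frac_scale t a + z) = to_fract (t * (u * v) + w)"
      by (simp add: frac_scale_def algebra_simps)
    thus ?case by blast
  qed
  moreover have "frac_mod.subspace (ideal_mult I J)" by (simp add: ideal_mult_def)
  ultimately show ?thesis using r(1) s(1)
    unfolding fractional_ideal_def by (intro conjI exI[of _ "r * s"]) auto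
qed

lemma fractional_ideal_span_singleton: "fractional_ideal (frac_mod.span {x})"
proof -
  obtain a b where x: "x = Fraction_Field.Fract a b" "b \<noteq> 0" by (cases x) auto
  have "frac_scale b (frac_scale t x) = to_fract (t * a)" for t
    using x by (simp add: frac_scale_def to_fract_def eq_fract)
  hence "frac_scale b ` frac_mod.span {x} \<subseteq> range to_fract"
    by (simp add: frac_mod.span_singleton image_subset_iff del: to_fract_mult)
  thus ?thesis using x(2) unfolding fractional_ideal_def by auto
qed

lemma comm_group_invertible_ideals:
  "comm_group (invertible_ideal_group :: 'a::idom fract set monoid)"
proof (rule comm_groupI, unfold invertible_ideal_group_def, simp_all)
  let ?R = "range to_fract :: 'a fract set"
  have sub: "frac_mod.subspace I" if "invertible_ideal I" for I :: "'a fract set"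
    using that by (simp add: invertible_ideal_def fractional_ideal_def)
  show R: "invertible_ideal ?R"
    unfolding invertible_ideal_def
    using fractional_ideal_span_singleton[of "1 :: 'a fract"] ideal_mult_one[of ?R]
    by (auto simp: range_to_fract)
  show "ideal_mult ?R I = I" if "invertible_ideal I" for I
    by (rule ideal_mult_one[OF sub[OF that]])
  show "ideal_mult I J = ideal_mult J I" for I J :: "'a fract set"
    by (rule ideal_mult_commute)
  show "ideal_mult (ideal_mult I J) K = ideal_mult I (ideal_mult J K)"
    if "invertible_ideal I" "invertible_ideal J" "invertible_ideal K" for I J K :: "'a fract set"
    using that by (intro ideal_mult_assoc sub)
  show "\<exists>J. invertible_ideal J \<and> ideal_mult J I = ?R" if "invertible_ideal I" for I
    using that unfolding invertible_ideal_def by (metis ideal_mult_commute)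
  show "invertible_ideal (ideal_mult I J)"
    if IJ: "invertible_ideal I" "invertible_ideal J" for I J :: "'a fract set"
  proof -
    obtain I' J' where I': "fractional_ideal I'" "ideal_mult I I' = ?R"
      and J': "fractional_ideal J'" "ideal_mult J J' = ?R"
      using IJ by (auto simp: invertible_ideal_def)
    have s: "frac_mod.subspace I" "frac_mod.subspace J" "frac_mod.subspace I'" "frac_mod.subspace J'"
      using IJ I' J' by (auto simp: invertible_ideal_def fractional_ideal_def)
    have p: "frac_mod.subspace (ideal_mult A B)" for A B :: "'a fract set"
      by (simp add: ideal_mult_def)
    have "ideal_mult (ideal_mult I J) (ideal_mult J' I')
        = ideal_mult I (ideal_mult (ideal_mult J J') I')"
      using s p by (simp add: ideal_mult_assoc)
    also have "\<dots> = ?R" by (simp add: I' J' ideal_mult_one s)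
    finally show ?thesis
      using IJ I' J' unfolding invertible_ideal_def by (blast intro: fractional_ideal_mult)
  qed
qed

lemma normal_principal_ideals:
  "normal principal_ideals (invertible_ideal_group :: 'a::idom fract set monoid)"
proof -
  interpret G: comm_group "invertible_ideal_group :: 'a fract set monoid"
    by (rule comm_group_invertible_ideals)
  have m: "ideal_mult (frac_mod.span {x}) (frac_mod.span {y}) = frac_mod.span {x * y}"
    for x y :: "'a fract" by (simp add: ideal_mult_span)
  have inv: "ideal_mult (frac_mod.span {x}) (frac_mod.span {inverse x}) = range to_fract"
    if "x \<noteq> 0" for x :: "'a fract" using that by (simp add: m range_to_fract)
  have c: "invertible_ideal (frac_mod.span {x})" if "x \<noteq> 0" for x :: "'a fract"
    unfolding invertible_ideal_def using inv[OF that] fractional_ideal_span_singleton by blast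
  have "subgroup principal_ideals (invertible_ideal_group :: 'a fract set monoid)"
  proof (rule G.subgroupI)
    show "principal_ideals \<subseteq> carrier (invertible_ideal_group :: 'a fract set monoid)"
      by (auto simp: principal_ideals_def invertible_ideal_group_def c)
    show "principal_ideals \<noteq> ({} :: 'a fract set set)"
    proof -
      have "frac_mod.span {1 :: 'a fract} \<in> principal_ideals"
        unfolding principal_ideals_def using one_neq_zero by blast
      thus ?thesis by blast
    qed
    show "a \<otimes>\<^bsub>invertible_ideal_group\<^esub> b \<in> principal_ideals"
      if ab: "a \<in> principal_ideals" "b \<in> principal_ideals" for a b :: "'a fract set"
    proof -
      obtain x y where "a = frac_mod.span {x}" "x \<noteq> 0" "b = frac_mod.span {y}" "y \<noteq> 0"
        using ab unfolding principal_ideals_def by blast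
      hence "a \<otimes>\<^bsub>invertible_ideal_group\<^esub> b = frac_mod.span {x * y}" "x * y \<noteq> 0"
        by (simp_all add: invertible_ideal_group_def m)
      thus ?thesis unfolding principal_ideals_def by blast
    qed
    show "inv\<^bsub>invertible_ideal_group\<^esub> a \<in> principal_ideals"
      if ab: "a \<in> principal_ideals" for a :: "'a fract set"
    proof -
      obtain x where x: "a = frac_mod.span {x}" "x \<noteq> 0"
        using ab unfolding principal_ideals_def by blast
      have "inv\<^bsub>invertible_ideal_group\<^esub> a = frac_mod.span {inverse x}"
        using x c[of x] c[of "inverse x"] inv[of x]
        by (intro G.inv_equality) (simp_all add: invertible_ideal_group_def ideal_mult_commute)
      moreover have "inverse x \<noteq> 0" using x by simp
      ultimately show ?thesis unfolding principal_ideals_def by blast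
    qed
  qed
  thus ?thesis by (rule G.subgroup_imp_normal)
qed

definition class_group :: "'a::idom fract set set monoid" where
  "class_group = invertible_ideal_group Mod principal_ideals"

definition ideal_class :: "'a::idom fract set \<Rightarrow> 'a fract set set" where
  "ideal_class I = principal_ideals #>\<^bsub>invertible_ideal_group\<^esub> I"

definition torsion :: "('g, 'm) monoid_scheme \<Rightarrow> nat \<Rightarrow> 'g set" where
  "torsion G n = {g \<in> carrier G. g [^]\<^bsub>G\<^esub> n = \<one>\<^bsub>G\<^esub>}"

section \<open>Binary quadratic forms and ideal classes\<close>

definition ideal_gen2 :: "'a::comm_ring_1 \<Rightarrow> 'a \<Rightarrow> 'a set" where
  "ideal_gen2 \<alpha> \<beta> = {r * \<alpha> + s * \<beta> | r s. True}"

text \<open>The index of \<open>I\<close> in the ring, that is, the number of residue classes modulo \<open>I\<close>.\<close>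

definition ideal_norm :: "'a::comm_ring_1 set \<Rightarrow> nat" where
  "ideal_norm I = card (UNIV // {(x, y). x - y \<in> I})"

text \<open>If the discriminant is negative, then \<open>N (- \<beta> x + \<alpha> y) / N \<langle>\<alpha>, \<beta>\<rangle>\<close>, with the
  positive ideal norm, is always positive definite. A negative definite form \<open>q\<close> is therefore
  assigned the classes of \<open>- q\<close>, which amounts to the ideal norm signed by the orientation of
  \<open>(\<alpha>, \<beta>)\<close>; for all other forms the sign is \<open>1\<close>.\<close>

definition form_sign :: "int \<Rightarrow> int \<Rightarrow> int \<Rightarrow> int" where
  "form_sign a b c = (if b\<^sup>2 - 4 * a * c < 0 \<and> a < 0 then - 1 else 1)"

text \<open>The form \<open>a x\<^sup>2 + b x y + c y\<^sup>2\<close> corresponds to the ideal class \<open>C\<close>. The identity of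
  polynomials in \<open>x\<close> and \<open>y\<close> is expressed by its validity at all integers. Conjugating \<open>\<alpha>\<close>
  and \<open>\<beta>\<close> leaves the form unchanged, so \<open>C\<close> is determined by the form only
  up to inversion, which is immaterial for membership in a torsion subgroup.\<close>

definition corresponds_to ::
  "'a::idom \<Rightarrow> 'a \<Rightarrow> int \<Rightarrow> int \<Rightarrow> int \<Rightarrow> 'a fract set set \<Rightarrow> bool" where
  "corresponds_to \<omega>\<^sub>1 \<omega>\<^sub>2 a b c C \<longleftrightarrow>
     (\<exists>\<alpha> \<beta>.
        invertible_ideal (to_fract ` ideal_gen2 \<alpha> \<beta>) \<and>
        C = ideal_class (to_fract ` ideal_gen2 \<alpha> \<beta>) \<and>
        (\<forall>x y :: int.
           (of_int (form_sign a b c * (a * x\<^sup>2 + b * x * y + c * y\<^sup>2)) :: rat) =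
           of_int (norm_int \<omega>\<^sub>1 \<omega>\<^sub>2 (- \<beta> * of_int x + \<alpha> * of_int y))
           / of_nat (ideal_norm (ideal_gen2 \<alpha> \<beta>))))"

text \<open>A binary form \<open>\<Sum> t\<^sub>i x\<^sup>i y\<^sup>n\<^sup>-\<^sup>i\<close> is represented by its dehomogenization at \<open>y = 1\<close>
  together with its formal degree \<open>n\<close>; \<open>resultant_sub\<close> takes the determinant of the Sylvester
  matrix for the given formal degrees, even where leading coefficients vanish.\<close>

definition form_resultant ::
  "int \<Rightarrow> int \<Rightarrow> int \<Rightarrow> nat \<Rightarrow> (nat \<Rightarrow> int) \<Rightarrow> int" where
  "form_resultant a b c n t = resultant_sub 2 n [:c, b, a:] (\<Sum>i\<le>n. monom (t i) i)"

end

theory Submission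
  imports Defs
begin

text \<open>If \<open>\<langle>\<alpha>, \<beta>\<rangle>\<close> corresponds to \<open>q\<close>, then \<open>\<theta> = \<alpha> / \<beta>\<close> is a root of \<open>a x\<^sup>2 + b x + c\<close>, and
  the ideal is \<open>\<beta> I\<close> with \<open>I = \<langle>1, \<theta>\<rangle> = \<int> + \<int> \<theta>\<close>. The power \<open>I\<^sup>n\<close> is the set of all
  \<open>\<phi>(\<theta>, 1)\<close> for integral binary forms \<open>\<phi>\<close> of degree \<open>n\<close>, so if it is principal, it is
  generated by some \<open>\<phi>(\<theta>, 1)\<close>. As \<open>I\<close> is invertible, \<open>\<phi>(\<theta>, 1)\<close> generates \<open>I\<^sup>n\<close> iff
  \<open>\<phi>(\<theta>, 1) I = I\<^sup>n\<^sup>+\<^sup>1\<close>. By Gauss' lemma this means that every form of degree \<open>n + 1\<close> is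
  \<open>A q + B \<phi>\<close> with \<open>A\<close> of degree \<open>n - 1\<close> and \<open>B\<close> linear, that is, that the Sylvester matrix
  of \<open>q\<close> and \<open>\<phi>\<close> is invertible over \<open>\<int>\<close>.\<close>

section \<open>Resultants that are units\<close>

text \<open>In monomial bases, the transposed Sylvester matrix is the matrix of the map (A, B) |-> A
  p + B q, from pairs with deg A < n and deg B < m to polynomials of degree below m + n. A square
  integer matrix is onto exactly if its determinant is a unit. Only the formal degrees m and n
  enter, so vanishing leading coefficients do no harm.\<close>

lemma resultant_sub_unit_iff:
  fixes p q :: "int poly"
  assumes p: "degree p \<le> m" and q: "degree q \<le> n" and "m > 0" "n > 0"
  shows "resultant_sub m n p q \<in> {1, - 1} \<longleftrightarrow>
    (\<forall>h. degree h < m + n \<longrightarrow> (\<exists>A B. degree A < n \<and> degree B < m \<and> h = A * p + B * q))"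
proof -
  define N where "N = m + n"
  define T where "T = transpose_mat (sylvester_mat_sub m n p q)"
  have T: "T \<in> carrier_mat N N" by (simp add: T_def N_def carrier_matI)
  have det: "resultant_sub m n p q = det T"
    unfolding T_def resultant_sub_def by (rule det_transpose[symmetric, OF sylvester_mat_sub_carrier])
  \<comment> \<open>A vector of length N = n + m encodes the pair (A, B): its first n entries are
    the coefficients of A and its last m entries those of B, both with the highest power
    first.\<close>
  define A where "A v = (\<Sum>i<n. monom (v $ i) (n - 1 - i))" for v :: "int vec"
  define B where "B v = (\<Sum>i\<in>{n..<N}. monom (v $ i) (N - 1 - i))" for v :: "int vec"
  have dA: "degree (A v) < n" for v
  proof -
    have "degree (A v) \<le> n - 1" unfolding A_def
      by (rule degree_sum_le) (auto intro!: order.trans[OF degree_monom_le])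
    thus ?thesis using \<open>n > 0\<close> by simp
  qed
  have dB: "degree (B v) < m" for v
  proof -
    have "degree (B v) \<le> m - 1" unfolding B_def
      by (rule degree_sum_le) (auto intro!: order.trans[OF degree_monom_le] simp: N_def)
    thus ?thesis using \<open>m > 0\<close> by simp
  qed
  \<comment> \<open>Row j of \<open>T\<close> belongs to the power N - 1 - j, and column i holds the
    coefficients of a shift of p if i < n, of q otherwise.\<close>
  have coeffs: "(T *\<^sub>v v) $ j = coeff (A v * p + B v * q) (N - 1 - j)"
    if v: "v \<in> carrier_vec N" and j: "j < N" for v j
  proof -
    have S1: "T $$ (j, i) = coeff (monom 1 (n - 1 - i) * p) (N - 1 - j)" if i: "i < n" for i
      using i j p unfolding T_def N_def
      by (auto simp: sylvester_mat_sub_index coeff_monom_mult intro!: coeff_eq_0 arg_cong[of _ _ "coeff p"])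
    have S2: "T $$ (j, i) = coeff (monom 1 (N - 1 - i) * q) (N - 1 - j)" if i: "i \<in> {n..<N}" for i
      using i j q unfolding T_def N_def
      by (auto simp: sylvester_mat_sub_index coeff_monom_mult intro!: coeff_eq_0 arg_cong[of _ _ "coeff q"])
    have "(T *\<^sub>v v) $ j = (\<Sum>i<N. T $$ (j, i) * v $ i)"
      using T v j by (auto simp: scalar_prod_def atLeast0LessThan)
    also have "{..<N} = {..<n} \<union> {n..<N}" by (auto simp: N_def)
    also have "(\<Sum>i\<in>{..<n} \<union> {n..<N}. T $$ (j, i) * v $ i)
        = (\<Sum>i<n. T $$ (j, i) * v $ i) + (\<Sum>i\<in>{n..<N}. T $$ (j, i) * v $ i)"
      by (rule sum.union_disjoint) auto
    also have "(\<Sum>i<n. T $$ (j, i) * v $ i) = coeff (A v * p) (N - 1 - j)"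
    proof -
      have "(\<Sum>i<n. T $$ (j, i) * v $ i) = (\<Sum>i<n. coeff (monom (v $ i) (n - 1 - i) * p) (N - 1 - j))"
        by (intro sum.cong refl) (simp add: S1 coeff_monom_mult)
      thus ?thesis unfolding A_def sum_distrib_right coeff_sum .
    qed
    also have "(\<Sum>i\<in>{n..<N}. T $$ (j, i) * v $ i) = coeff (B v * q) (N - 1 - j)"
    proof -
      have "(\<Sum>i\<in>{n..<N}. T $$ (j, i) * v $ i)
          = (\<Sum>i\<in>{n..<N}. coeff (monom (v $ i) (N - 1 - i) * q) (N - 1 - j))"
        by (intro sum.cong refl) (simp add: S2 coeff_monom_mult)
      thus ?thesis unfolding B_def sum_distrib_right coeff_sum .
    qed
    finally show ?thesis by simp
  qed
  have dABs: "degree (A' * p + B' * q) < N" if "degree A' < n" "degree B' < m" for A' B'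
    using p q that degree_mult_le[of A' p] degree_mult_le[of B' q]
    by (intro degree_add_less) (simp_all add: N_def)
  define vec_of where "vec_of h = vec N (\<lambda>j. coeff h (N - 1 - j))" for h :: "int poly"
  have surj: "T *\<^sub>v v = vec_of h \<longleftrightarrow> h = A v * p + B v * q"
    if v: "v \<in> carrier_vec N" and h: "degree h < N" for v h
  proof
    assume "h = A v * p + B v * q"
    thus "T *\<^sub>v v = vec_of h"
      using T coeffs[OF v] by (intro eq_vecI) (auto simp: vec_of_def)
  next
    assume *: "T *\<^sub>v v = vec_of h"
    show "h = A v * p + B v * q"
    proof (rule poly_eqI)
      fix k
      show "coeff h k = coeff (A v * p + B v * q) k"
      proof (cases "k < N")
        case True
        hence "(vec_of h) $ (N - 1 - k) = coeff h k" by (simp add: vec_of_def)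
        thus ?thesis using coeffs[OF v, of "N - 1 - k"] True * by simp
      next
        case False
        thus ?thesis using h dABs[OF dA dB, of v v] by (simp add: coeff_eq_0 del: coeff_add)
      qed
    qed
  qed
  have ex_vec: "\<exists>v \<in> carrier_vec N. A v = A' \<and> B v = B'" if "degree A' < n" "degree B' < m" for A' B'
  proof -
    define v where "v = vec N (\<lambda>i. if i < n then coeff A' (n - 1 - i) else coeff B' (N - 1 - i))"
    have "A v = (\<Sum>i<n. monom (coeff A' (n - 1 - i)) (n - 1 - i))"
      unfolding A_def by (intro sum.cong refl) (simp add: v_def N_def)
    also have "\<dots> = (\<Sum>i<n. monom (coeff A' i) i)"
      by (rule sum.reindex_bij_witness[of _ "\<lambda>i. n - 1 - i" "\<lambda>i. n - 1 - i"]) auto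
    also have "\<dots> = A'" using that(1) poly_as_sum_of_monoms'[of A' "n - 1"] \<open>n > 0\<close>
      by (simp add: atMost_Suc lessThan_Suc_atMost[symmetric])
    finally have 1: "A v = A'" .
    have "B v = (\<Sum>i\<in>{n..<N}. monom (coeff B' (N - 1 - i)) (N - 1 - i))"
      unfolding B_def by (intro sum.cong refl) (simp add: v_def)
    also have "\<dots> = (\<Sum>i<m. monom (coeff B' i) i)"
      by (rule sum.reindex_bij_witness[of _ "\<lambda>i. N - 1 - i" "\<lambda>i. N - 1 - i"]) (auto simp: N_def)
    also have "\<dots> = B'" using that(2) poly_as_sum_of_monoms'[of B' "m - 1"] \<open>m > 0\<close>
      by (simp add: atMost_Suc lessThan_Suc_atMost[symmetric])
    finally have 2: "B v = B'" .
    show ?thesis by (rule bexI[of _ v]) (simp_all add: 1 2, simp add: v_def)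
  qed
  have "det T \<in> {1, - 1} \<longleftrightarrow> (\<forall>h. degree h < N \<longrightarrow> (\<exists>v \<in> carrier_vec N. T *\<^sub>v v = vec_of h))"
  proof
    assume dT: "det T \<in> {1, - 1}"
    show "\<forall>h. degree h < N \<longrightarrow> (\<exists>v \<in> carrier_vec N. T *\<^sub>v v = vec_of h)"
    proof (intro allI impI)
      fix h :: "int poly"
      \<comment> \<open>Since T times its adjugate is det T, the vector \<open>T *\<^sub>v u\<close>
        is det T times the target; as the square of det T is 1, det T times \<open>u\<close> is an
        integral preimage.\<close>
      define u where "u = adj_mat T *\<^sub>v vec_of h"
      have vh: "vec_of h \<in> carrier_vec N" by (simp add: vec_of_def)
      have u: "u \<in> carrier_vec N"
        using adj_mat(1)[OF T] vh by (simp add: u_def)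
      have "T *\<^sub>v (det T \<cdot>\<^sub>v u) = det T \<cdot>\<^sub>v (T *\<^sub>v u)"
        using T u by (intro eq_vecI) (auto simp: scalar_prod_smult_right)
      also have "T *\<^sub>v u = (T * adj_mat T) *\<^sub>v vec_of h"
        unfolding u_def using adj_mat(1)[OF T] T vh by simp
      also have "\<dots> = det T \<cdot>\<^sub>v vec_of h"
        unfolding adj_mat(2)[OF T] using vh by (intro eq_vecI) auto
      also have "det T \<cdot>\<^sub>v (det T \<cdot>\<^sub>v vec_of h) = vec_of h"
        using dT by (auto simp: smult_smult_assoc)
      finally show "\<exists>v \<in> carrier_vec N. T *\<^sub>v v = vec_of h"
        using u by (intro bexI[of _ "det T \<cdot>\<^sub>v u"]) auto
    qed
  next
    assume *: "\<forall>h. degree h < N \<longrightarrow> (\<exists>v \<in> carrier_vec N. T *\<^sub>v v = vec_of h)"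
    \<comment> \<open>Preimages of the unit vectors are the columns of an integral right inverse
      \<open>X\<close>, whence det T divides 1.\<close>
    have "\<exists>v \<in> carrier_vec N. T *\<^sub>v v = unit_vec N k" if k: "k < N" for k
    proof -
      have "vec_of (monom 1 (N - 1 - k)) = unit_vec N k"
        using k by (intro eq_vecI) (auto simp: vec_of_def)
      moreover have "degree (monom (1::int) (N - 1 - k)) < N" using k by (simp add: degree_monom_eq)
      ultimately show ?thesis using * by metis
    qed
    then obtain w where w: "\<And>k. k < N \<Longrightarrow> w k \<in> carrier_vec N \<and> T *\<^sub>v w k = unit_vec N k" by metis
    define X where "X = mat N N (\<lambda>(i, k). w k $ i)"
    have X: "X \<in> carrier_mat N N" by (simp add: X_def)
    have "T * X = 1\<^sub>m N"
    proof (rule eq_matI)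
      fix i k assume ik: "i < dim_row (1\<^sub>m N)" "k < dim_col (1\<^sub>m N)"
      hence "col X k = w k" using w[of k] by (intro eq_vecI) (auto simp: X_def)
      hence "(T * X) $$ (i, k) = (T *\<^sub>v w k) $ i" using ik T X by simp
      thus "(T * X) $$ (i, k) = 1\<^sub>m N $$ (i, k)" using w[of k] ik by simp
    qed (use T X in auto)
    hence "det T * det X = 1" using det_mult[OF T X] by simp
    thus "det T \<in> {1, - 1}" by (auto simp: zmult_eq_1_iff)
  qed
  also have "\<dots> \<longleftrightarrow> (\<forall>h. degree h < N \<longrightarrow> (\<exists>v \<in> carrier_vec N. h = A v * p + B v * q))"
    using surj by blast
  also have "\<dots> \<longleftrightarrow> (\<forall>h. degree h < N \<longrightarrow>
      (\<exists>A B. degree A < n \<and> degree B < m \<and> h = A * p + B * q))"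
    using dA dB ex_vec by metis
  finally show ?thesis unfolding det N_def .
qed

section \<open>Quadratic orders\<close>

lemma int_basis_unique:
  assumes "int_basis \<omega>\<^sub>1 \<omega>\<^sub>2"
    and "of_int p * \<omega>\<^sub>1 + of_int q * \<omega>\<^sub>2 = of_int r * \<omega>\<^sub>1 + of_int s * \<omega>\<^sub>2"
  shows "p = r \<and> q = s"
  using assms unfolding int_basis_def
  by (metis fst_conv snd_conv)

lemma int_basis_obtain:
  assumes "int_basis \<omega>\<^sub>1 \<omega>\<^sub>2"
  obtains p q where "x = of_int p * \<omega>\<^sub>1 + of_int q * \<omega>\<^sub>2"
  using assms unfolding int_basis_def by metis

lemma int_coords_eq:
  assumes "int_basis \<omega>\<^sub>1 \<omega>\<^sub>2" "x = of_int p * \<omega>\<^sub>1 + of_int q * \<omega>\<^sub>2"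
  shows "int_coords \<omega>\<^sub>1 \<omega>\<^sub>2 x = (p, q)"
  unfolding int_coords_def
proof (rule the_equality)
  fix y assume "x = of_int (fst y) * \<omega>\<^sub>1 + of_int (snd y) * \<omega>\<^sub>2"
  hence "fst y = p \<and> snd y = q" using int_basis_unique[OF assms(1)] assms(2) by metis
  thus "y = (p, q)" by (simp add: prod_eq_iff)
qed (use assms in simp)

lemma int_basis_one_eq0:
  assumes "int_basis 1 \<omega>" "of_int u + of_int v * \<omega> = 0"
  shows "u = 0 \<and> v = 0"
  using int_basis_unique[OF assms(1), of u v 0 0] assms(2) by simp

text \<open>The element 1 is a primitive vector of the lattice: if 1 = g y, then
  \<open>\<omega>\<^sub>1\<close> = g (y \<open>\<omega>\<^sub>1\<close>), and comparing first
  coordinates shows that g divides 1. Bezout then completes the coordinates of 1 to an integer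
  matrix of determinant 1.\<close>

lemma int_basis_one_exists:
  fixes \<omega>\<^sub>1 \<omega>\<^sub>2 :: "'a::idom"
  assumes bas: "int_basis \<omega>\<^sub>1 \<omega>\<^sub>2"
  obtains \<omega> p q r s where "p * s - q * r = 1" "int_basis 1 \<omega>"
    "\<omega>\<^sub>1 = of_int s - of_int q * \<omega>" "\<omega>\<^sub>2 = of_int p * \<omega> - of_int r"
proof -
  obtain p q where pq: "1 = of_int p * \<omega>\<^sub>1 + of_int q * \<omega>\<^sub>2"
    using int_basis_obtain[OF bas] .
  define g where "g = gcd p q"
  obtain p' q' where g: "p = g * p'" "q = g * q'" unfolding g_def by (meson dvdE gcd_dvd1 gcd_dvd2)
  obtain u v where uv: "(of_int p' * \<omega>\<^sub>1 + of_int q' * \<omega>\<^sub>2) * \<omega>\<^sub>1 = of_int u * \<omega>\<^sub>1 + of_int v * \<omega>\<^sub>2"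
    using int_basis_obtain[OF bas] .
  have "\<omega>\<^sub>1 = of_int g * ((of_int p' * \<omega>\<^sub>1 + of_int q' * \<omega>\<^sub>2) * \<omega>\<^sub>1)"
    using arg_cong[OF pq, of "\<lambda>x. x * \<omega>\<^sub>1"] by (simp add: g algebra_simps)
  hence "of_int 1 * \<omega>\<^sub>1 + of_int 0 * \<omega>\<^sub>2 = of_int (g * u) * \<omega>\<^sub>1 + of_int (g * v) * \<omega>\<^sub>2"
    unfolding uv by (simp add: algebra_simps)
  hence "g * u = 1" using int_basis_unique[OF bas] by metis
  hence "is_unit (gcd p q)" unfolding g_def by (metis dvd_triv_left)
  hence "gcd p q = 1" by (simp add: is_unit_gcd)
  then obtain s r' where "s * p + r' * q = 1" using bezout_int[of p q] by auto
  define r where "r = - r'"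
  have det: "p * s - q * r = 1" using \<open>s * p + r' * q = 1\<close> by (simp add: r_def algebra_simps)
  hence det': "of_int p * of_int s - of_int q * of_int r = (1 :: 'a)"
    by (metis of_int_1 of_int_diff of_int_mult)
  \<comment> \<open>The matrix with rows (p, q) and (r, s) takes the given basis to 1, \<omega>; the
    two formulas that follow are its inverse by Cramer's rule.\<close>
  define \<omega> where "\<omega> = of_int r * \<omega>\<^sub>1 + of_int s * \<omega>\<^sub>2"
  have 1: "\<omega>\<^sub>1 = of_int s - of_int q * \<omega>"
  proof -
    have "of_int s * 1 - of_int q * \<omega> = (of_int p * of_int s - of_int q * of_int r) * \<omega>\<^sub>1"
      unfolding pq \<omega>_def by (simp add: algebra_simps)
    thus ?thesis by (simp add: det')
  qed
  have 2: "\<omega>\<^sub>2 = of_int p * \<omega> - of_int r"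
  proof -
    have "of_int p * \<omega> - of_int r * 1 = (of_int p * of_int s - of_int q * of_int r) * \<omega>\<^sub>2"
      unfolding pq \<omega>_def by (simp add: algebra_simps)
    thus ?thesis by (simp add: det')
  qed
  have "int_basis 1 \<omega>" unfolding int_basis_def
  proof (intro allI ex_ex1I)
    fix x
    obtain u v where x: "x = of_int u * \<omega>\<^sub>1 + of_int v * \<omega>\<^sub>2" using int_basis_obtain[OF bas] .
    have "x = of_int (u * s - v * r) * 1 + of_int (v * p - u * q) * \<omega>"
      unfolding x 1 2 by (simp add: algebra_simps)
    thus "\<exists>y. x = of_int (fst y) * 1 + of_int (snd y) * \<omega>" by (metis fst_conv snd_conv)
  next
    fix x and y z :: "int \<times> int"
    assume y: "x = of_int (fst y) * 1 + of_int (snd y) * \<omega>"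
      and z: "x = of_int (fst z) * 1 + of_int (snd z) * \<omega>"
    have exp: "of_int u * 1 + of_int v * \<omega> = of_int (u * p + v * r) * \<omega>\<^sub>1 + of_int (u * q + v * s) * \<omega>\<^sub>2" for u v
      unfolding pq \<omega>_def by (simp add: algebra_simps)
    have e: "fst y * p + snd y * r = fst z * p + snd z * r \<and> fst y * q + snd y * s = fst z * q + snd z * s"
      by (rule int_basis_unique[OF bas]) (metis y z exp)
    define i j where "i = fst y - fst z" and "j = snd y - snd z"
    have "i * p + j * r = 0" "i * q + j * s = 0" using e by (simp_all add: i_def j_def algebra_simps)
    moreover have "i * (p * s - q * r) = s * (i * p + j * r) - r * (i * q + j * s)"
      "j * (p * s - q * r) = p * (i * q + j * s) - q * (i * p + j * r)"
      by (simp_all add: algebra_simps)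
    ultimately have "i = 0" "j = 0" by (simp_all only: det mult_zero_right diff_zero mult_1_right)
    thus "y = z" by (simp add: i_def j_def prod_eq_iff)
  qed
  thus ?thesis using that det 1 2 by blast
qed

text \<open>The characteristic polynomial of multiplication by x, evaluated at x, annihilates
  \<open>\<omega>\<^sub>1\<close>. In a domain this nonzero factor can be cancelled.\<close>

lemma norm_trace_Cayley_Hamilton:
  fixes \<omega>\<^sub>1 \<omega>\<^sub>2 :: "'a::idom"
  assumes bas: "int_basis \<omega>\<^sub>1 \<omega>\<^sub>2"
  shows "x\<^sup>2 - of_int (trace_int \<omega>\<^sub>1 \<omega>\<^sub>2 x) * x + of_int (norm_int \<omega>\<^sub>1 \<omega>\<^sub>2 x) = 0"
proof -
  obtain p q where 1: "x * \<omega>\<^sub>1 = of_int p * \<omega>\<^sub>1 + of_int q * \<omega>\<^sub>2" using int_basis_obtain[OF bas] .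
  obtain r s where 2: "x * \<omega>\<^sub>2 = of_int r * \<omega>\<^sub>1 + of_int s * \<omega>\<^sub>2" using int_basis_obtain[OF bas] .
  have T: "trace_int \<omega>\<^sub>1 \<omega>\<^sub>2 x = p + s" and N: "norm_int \<omega>\<^sub>1 \<omega>\<^sub>2 x = p * s - q * r"
    by (simp_all add: trace_int_def norm_int_def int_coords_eq[OF bas 1] int_coords_eq[OF bas 2])
  have "(x\<^sup>2 - (of_int p + of_int s) * x + (of_int p * of_int s - of_int q * of_int r)) * \<omega>\<^sub>1
      = x * (x * \<omega>\<^sub>1) - (of_int p + of_int s) * (x * \<omega>\<^sub>1)
        + (of_int p * of_int s - of_int q * of_int r) * \<omega>\<^sub>1"
    by (simp add: power2_eq_square algebra_simps)
  also have "x * (x * \<omega>\<^sub>1) = of_int p * (x * \<omega>\<^sub>1) + of_int q * (x * \<omega>\<^sub>2)"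
    by (subst 1) (simp add: algebra_simps)
  also have "of_int p * (x * \<omega>\<^sub>1) + of_int q * (x * \<omega>\<^sub>2) - (of_int p + of_int s) * (x * \<omega>\<^sub>1)
        + (of_int p * of_int s - of_int q * of_int r) * \<omega>\<^sub>1 = 0"
    unfolding 1 2 by (simp add: algebra_simps)
  finally have "(x\<^sup>2 - (of_int p + of_int s) * x + (of_int p * of_int s - of_int q * of_int r)) * \<omega>\<^sub>1 = 0" .
  moreover have "\<omega>\<^sub>1 \<noteq> 0"
    using int_basis_unique[OF bas, of 1 0 0 0] by auto
  ultimately show ?thesis by (simp add: T N)
qed

text \<open>This evaluates norm and trace, defined through the given basis, in the coordinates of
  another basis 1, \<omega>. If v = 0, multiplication is by the integer u. Otherwise the element is
  not an integer and satisfies only one monic quadratic equation over the integers, so the explicit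
  one must agree with the one from Cayley-Hamilton.\<close>

lemma norm_trace_int_eq:
  fixes \<omega>\<^sub>1 \<omega>\<^sub>2 :: "'a::idom"
  assumes bas: "int_basis \<omega>\<^sub>1 \<omega>\<^sub>2" and bas': "int_basis 1 \<omega>"
    and sq: "\<omega>\<^sup>2 = of_int t * \<omega> - of_int m"
  shows "trace_int \<omega>\<^sub>1 \<omega>\<^sub>2 (of_int u + of_int v * \<omega>) = 2 * u + t * v"
    and "norm_int \<omega>\<^sub>1 \<omega>\<^sub>2 (of_int u + of_int v * \<omega>) = u\<^sup>2 + t * u * v + m * v\<^sup>2"
proof -
  let ?x = "of_int u + of_int v * \<omega>"
  let ?T = "trace_int \<omega>\<^sub>1 \<omega>\<^sub>2 ?x" and ?N = "norm_int \<omega>\<^sub>1 \<omega>\<^sub>2 ?x"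
  have "?T = 2 * u + t * v \<and> ?N = u\<^sup>2 + t * u * v + m * v\<^sup>2"
  proof (cases "v = 0")
    case True
    have "int_coords \<omega>\<^sub>1 \<omega>\<^sub>2 (?x * \<omega>\<^sub>1) = (u, 0)" "int_coords \<omega>\<^sub>1 \<omega>\<^sub>2 (?x * \<omega>\<^sub>2) = (0, u)"
      by (rule int_coords_eq[OF bas], simp add: True)+
    thus ?thesis by (simp add: trace_int_def norm_int_def True power2_eq_square)
  next
    case False
    have "?x\<^sup>2 - (2 * of_int u + of_int t * of_int v) * ?x
        + ((of_int u)\<^sup>2 + of_int t * of_int u * of_int v + of_int m * (of_int v)\<^sup>2)
        = (of_int v)\<^sup>2 * (\<omega>\<^sup>2 - of_int t * \<omega> + of_int m)"
      by (simp add: power2_eq_square algebra_simps)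
    also have "\<dots> = 0" by (simp add: sq)
    finally have "?x\<^sup>2 - (2 * of_int u + of_int t * of_int v) * ?x
        + ((of_int u)\<^sup>2 + of_int t * of_int u * of_int v + of_int m * (of_int v)\<^sup>2) = 0" .
    note e = this norm_trace_Cayley_Hamilton[OF bas, of ?x]
    \<comment> \<open>In the difference of the two equations the squares cancel, which leaves an
      integral relation between 1 and \<omega>.\<close>
    have "of_int ((u\<^sup>2 + t * u * v + m * v\<^sup>2 - ?N) + (?T - (2 * u + t * v)) * u)
        + of_int ((?T - (2 * u + t * v)) * v) * \<omega>
      = (?x\<^sup>2 - (2 * of_int u + of_int t * of_int v) * ?x
        + ((of_int u)\<^sup>2 + of_int t * of_int u * of_int v + of_int m * (of_int v)\<^sup>2))
        - (?x\<^sup>2 - of_int ?T * ?x + of_int ?N)"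
      by (simp add: algebra_simps)
    also have "\<dots> = 0" unfolding e by simp
    finally have *: "of_int ((u\<^sup>2 + t * u * v + m * v\<^sup>2 - ?N) + (?T - (2 * u + t * v)) * u)
        + of_int ((?T - (2 * u + t * v)) * v) * \<omega> = 0" .
    show ?thesis using int_basis_one_eq0[OF bas' *] False by auto
  qed
  thus "?T = 2 * u + t * v" "?N = u\<^sup>2 + t * u * v + m * v\<^sup>2" by auto
qed

text \<open>A change of basis multiplies the discriminant by the square of its determinant, here 1,
  and the basis 1, \<omega> has the discriminant of the polynomial X^2 - t X + m.\<close>

lemma discriminant_eq:
  fixes \<omega>\<^sub>1 \<omega>\<^sub>2 :: "'a::idom"
  assumes bas: "int_basis \<omega>\<^sub>1 \<omega>\<^sub>2" and bas': "int_basis 1 \<omega>"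
    and sq: "\<omega>\<^sup>2 = of_int t * \<omega> - of_int m"
    and 1: "\<omega>\<^sub>1 = of_int s - of_int q * \<omega>" and 2: "\<omega>\<^sub>2 = of_int p * \<omega> - of_int r"
    and det: "p * s - q * r = 1"
  shows "discriminant \<omega>\<^sub>1 \<omega>\<^sub>2 = t\<^sup>2 - 4 * m"
proof -
  note T = norm_trace_int_eq(1)[OF bas bas' sq]
  have "(of_int x + of_int y * \<omega>) * (of_int z + of_int w * \<omega>)
      = of_int (x * z - m * y * w) + of_int (x * w + y * z + t * y * w) * \<omega>" for x y z w
  proof -
    have "(of_int x + of_int y * \<omega>) * (of_int z + of_int w * \<omega>)
      = of_int (x * z) + of_int (x * w + y * z) * \<omega> + of_int (y * w) * \<omega>\<^sup>2"
      by (simp add: power2_eq_square algebra_simps)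
    thus ?thesis unfolding sq by (simp add: algebra_simps)
  qed
  hence T': "trace_int \<omega>\<^sub>1 \<omega>\<^sub>2 ((of_int x + of_int y * \<omega>) * (of_int z + of_int w * \<omega>))
      = 2 * (x * z - m * y * w) + t * (x * w + y * z + t * y * w)" for x y z w
    by (simp only: T)
  have e: "\<omega>\<^sub>1 = of_int s + of_int (- q) * \<omega>" "\<omega>\<^sub>2 = of_int (- r) + of_int p * \<omega>"
    using 1 2 by simp_all
  have "discriminant \<omega>\<^sub>1 \<omega>\<^sub>2 = (p * s - q * r)\<^sup>2 * (t\<^sup>2 - 4 * m)"
    unfolding discriminant_def
      T'[of s "-q" s "-q", folded e] T'[of s "-q" "-r" p, folded e]
      T'[of "-r" p "-r" p, folded e] T'[of "-r" p s "-q", folded e]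
    by (simp add: power2_eq_square algebra_simps)
  thus ?thesis by (simp add: det)
qed

text \<open>The discriminant determines the order: some \<omega> with trace t and norm m completes 1
  to a basis, and t^2 - 4 m = b^2 - 4 a c forces t and b to have the same parity. An integer shift
  therefore gives a generator \<tau> with trace - b, and equality of discriminants makes its norm a
  c. This is the equation of a times a root of a x^2 + b x + c.\<close>

lemma order_generator_exists:
  fixes \<omega>\<^sub>1 \<omega>\<^sub>2 :: "'a::idom"
  assumes bas: "int_basis \<omega>\<^sub>1 \<omega>\<^sub>2" and disc: "discriminant \<omega>\<^sub>1 \<omega>\<^sub>2 = b\<^sup>2 - 4 * a * c"
  obtains \<tau> where "int_basis 1 \<tau>" "\<tau>\<^sup>2 = - of_int b * \<tau> - of_int (a * c)"
    "\<And>u v. norm_int \<omega>\<^sub>1 \<omega>\<^sub>2 (of_int u + of_int v * \<tau>) = u\<^sup>2 - b * u * v + a * c * v\<^sup>2"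
proof -
  obtain \<omega> p q r s where w: "p * s - q * r = 1" "int_basis 1 \<omega>"
    "\<omega>\<^sub>1 = of_int s - of_int q * \<omega>" "\<omega>\<^sub>2 = of_int p * \<omega> - of_int r"
    using int_basis_one_exists[OF bas] .
  obtain m' t where "\<omega>\<^sup>2 = of_int m' * 1 + of_int t * \<omega>" using int_basis_obtain[OF w(2)] .
  define m where "m = - m'"
  have sq: "\<omega>\<^sup>2 = of_int t * \<omega> - of_int m" unfolding m_def by (simp add: \<open>\<omega>\<^sup>2 = _\<close>)
  have d: "t\<^sup>2 - 4 * m = b\<^sup>2 - 4 * a * c"
    using discriminant_eq[OF bas w(2) sq w(3,4,1)] disc by simp
  have "even (t\<^sup>2 - b\<^sup>2)"
  proof -
    have "t\<^sup>2 - b\<^sup>2 = 2 * (2 * m - 2 * (a * c))" using d by simp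
    thus ?thesis by simp
  qed
  hence "even (- b - t)" by (simp add: power2_eq_square)
  then obtain k where k: "- b - t = 2 * k" by (elim evenE)
  have t: "t = - b - 2 * k" using k by simp
  have m: "m = a * c + b * k + k\<^sup>2" using d unfolding t by (simp add: power2_eq_square algebra_simps)
  define \<tau> where "\<tau> = \<omega> + of_int k"
  have \<omega>: "\<omega> = \<tau> - of_int k" by (simp add: \<tau>_def)
  have sq': "\<tau>\<^sup>2 = of_int (- b) * \<tau> - of_int (a * c)"
  proof -
    have "\<tau>\<^sup>2 = \<omega>\<^sup>2 + 2 * of_int k * \<omega> + (of_int k)\<^sup>2"
      by (simp add: \<tau>_def power2_eq_square algebra_simps)
    thus ?thesis unfolding sq unfolding t m \<omega> by (simp add: power2_eq_square algebra_simps)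
  qed
  have bas': "int_basis 1 \<tau>" unfolding int_basis_def
  proof (intro allI ex_ex1I)
    fix x
    obtain u v where "x = of_int u * 1 + of_int v * \<omega>" using int_basis_obtain[OF w(2)] .
    hence "x = of_int (u - v * k) * 1 + of_int v * \<tau>" by (simp add: \<omega> algebra_simps)
    thus "\<exists>y. x = of_int (fst y) * 1 + of_int (snd y) * \<tau>" by (metis fst_conv snd_conv)
  next
    fix x and y z :: "int \<times> int"
    assume "x = of_int (fst y) * 1 + of_int (snd y) * \<tau>" "x = of_int (fst z) * 1 + of_int (snd z) * \<tau>"
    hence "of_int (fst y + snd y * k) * 1 + of_int (snd y) * \<omega>
        = of_int (fst z + snd z * k) * 1 + of_int (snd z) * \<omega>"
      by (simp add: \<tau>_def algebra_simps)
    hence "fst y + snd y * k = fst z + snd z * k \<and> snd y = snd z"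
      by (rule int_basis_unique[OF w(2)])
    thus "y = z" by (auto simp: prod_eq_iff)
  qed
  show ?thesis
    using that[OF bas'] sq' norm_trace_int_eq(2)[OF bas bas' sq'] by simp
qed

section \<open>Powers of the ideal \<open>\<langle>1, \<theta>\<rangle>\<close>\<close>

lemma to_fract_of_int [simp]: "to_fract (of_int k) = of_int k"
proof -
  have "to_fract (of_nat m) = of_nat m" for m by (induction m) simp_all
  moreover obtain m where "k = of_nat m \<or> k = - of_nat m" by (cases k rule: int_cases2) auto
  ultimately show ?thesis by auto
qed

lemma principal_times_ideal:
  assumes "frac_mod.subspace I"
  shows "ideal_mult (frac_mod.span {\<gamma>}) I = (*) \<gamma> ` I"
proof -
  have I: "frac_mod.span I = I" using assms by (simp add: frac_mod.span_eq_iff)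
  have "ideal_mult (frac_mod.span {\<gamma>}) I = frac_mod.span {x * y | x y. x \<in> {\<gamma>} \<and> y \<in> I}"
    using ideal_mult_span[of "{\<gamma>}" I] by (simp only: I)
  also have "{x * y | x y. x \<in> {\<gamma>} \<and> y \<in> I} = (*) \<gamma> ` I" by auto
  also have "frac_mod.subspace ((*) \<gamma> ` I)"
    unfolding frac_mod.subspace_def
  proof (intro conjI ballI allI)
    show "0 \<in> (*) \<gamma> ` I" using frac_mod.subspace_0[OF assms] by force
    show "x + y \<in> (*) \<gamma> ` I" if "x \<in> (*) \<gamma> ` I" "y \<in> (*) \<gamma> ` I" for x y
      using that frac_mod.subspace_add[OF assms] by (auto simp flip: distrib_left)
    show "frac_scale r x \<in> (*) \<gamma> ` I" if x: "x \<in> (*) \<gamma> ` I" for r x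
    proof -
      obtain y where "x = \<gamma> * y" "y \<in> I" using x by blast
      moreover have "frac_scale r (\<gamma> * y) = \<gamma> * frac_scale r y" by (simp add: frac_scale_def ac_simps)
      ultimately show ?thesis using frac_mod.subspace_scale[OF assms] by (metis image_eqI)
    qed
  qed
  hence "frac_mod.span ((*) \<gamma> ` I) = (*) \<gamma> ` I" by (simp add: frac_mod.span_eq_iff)
  finally show ?thesis .
qed

text \<open>The setting in which powers of the ideal are computed. The root \<theta> need not be
  integral, but a \<theta> is a root of X^2 + b X + a c and forms with 1 a basis of the
  order.\<close>

locale quadratic_form_root =
  fixes a b c :: int and \<theta> :: "'a::idom fract"
  assumes root: "of_int a * \<theta>\<^sup>2 + of_int b * \<theta> + of_int c = 0"
    and order_basis: "range to_fract = {of_int u + of_int v * (of_int a * \<theta>) | u v. True}"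
    and indep: "of_int u + of_int v * \<theta> = 0 \<Longrightarrow> u = 0 \<and> v = 0"
    and primitive: "gcd a (gcd b c) = 1"
begin

definition Q :: "int poly" where "Q = [:c, b, a:]"

definition ev :: "int poly \<Rightarrow> 'a fract" where "ev p = poly (map_poly of_int p) \<theta>"

text \<open>Dehomogenized at y = 1, the forms of degree n are the polynomials of degree at most n,
  so \<open>L n\<close> is the additive group generated by 1, \<theta>, ..., \<theta>^n.\<close>

definition L :: "nat \<Rightarrow> 'a fract set" where "L n = ev ` {p. degree p \<le> n}"

lemma ev_simps [simp]:
  "ev 0 = 0" "ev 1 = 1" "ev (pCons k p) = of_int k + \<theta> * ev p" "ev (p + q) = ev p + ev q"
  "ev (p - q) = ev p - ev q" "ev (p * q) = ev p * ev q" "ev (smult k p) = of_int k * ev p"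
  by (simp_all add: ev_def hom_distribs)

lemma ev_Q [simp]: "ev Q = 0"
  using root by (simp add: Q_def power2_eq_square algebra_simps)

lemma a_nonzero: "a \<noteq> 0"
proof
  assume [simp]: "a = 0"
  have "of_int c + of_int b * \<theta> = 0" using root by (simp add: add.commute)
  hence "c = 0 \<and> b = 0" by (rule indep)
  thus False using primitive by simp
qed

lemma of_int_eq_0 [simp]: "(of_int k :: 'a fract) = 0 \<longleftrightarrow> k = 0"
  using indep[of k 0] by auto

lemma degree_Q [simp]: "degree Q = 2"
  using a_nonzero by (simp add: Q_def)

lemma coeff_Q_2 [simp]: "coeff Q 2 = a"
  by (simp add: Q_def numeral_2_eq_2)

lemma L_I: "degree p \<le> n \<Longrightarrow> ev p \<in> L n"
  by (auto simp: L_def)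

lemma to_fract_obtain:
  obtains u v where "to_fract r = of_int u + of_int v * (of_int a * \<theta>)"
  using order_basis by blast

text \<open>Only multiplication by a \<theta> needs an argument. It raises the degree of a
  polynomial by one, and a multiple of \<open>Q\<close>, which vanishes at \<theta>, brings the
  degree back down. For n = 0 this fails, since \<open>L 0\<close> consists of the integers.\<close>

lemma subspace_L:
  assumes "n \<ge> 1"
  shows "frac_mod.subspace (L n)"
  unfolding frac_mod.subspace_def
proof (intro conjI ballI allI)
  show "0 \<in> L n" using L_I[of 0 n] by simp
  show "x + y \<in> L n" if xy: "x \<in> L n" "y \<in> L n" for x y
  proof -
    obtain p q where "x = ev p" "y = ev q" "degree p \<le> n" "degree q \<le> n" using xy by (auto simp: L_def)
    thus ?thesis using L_I[of "p + q" n] by (simp add: degree_add_le)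
  qed
  show "frac_scale r x \<in> L n" if x: "x \<in> L n" for r x
  proof -
    obtain p where p: "x = ev p" "degree p \<le> n" using x by (auto simp: L_def)
    obtain u v where r: "to_fract r = of_int u + of_int v * (of_int a * \<theta>)" by (rule to_fract_obtain)
    \<comment> \<open>If t is the coefficient of x^n in p, the coefficient of x^(n + 1) in a x p is
      a t, and t x^(n - 1) \<open>Q\<close> has the same one.\<close>
    define s where "s = smult a (pCons 0 p) - monom (coeff p n) (n - 1) * Q"
    have s: "degree s \<le> n"
    proof (rule degree_le, intro allI impI)
      fix k assume k: "n < k"
      obtain n' where n: "n = Suc n'" using assms by (cases n) auto
      obtain k' where k': "k = Suc (Suc k')" using k n by (cases k; cases "k - 1") auto
      have "k' = n' \<or> k' > n'" using k n k' by auto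
      thus "coeff s k = 0" using p(2) n k'
        by (auto simp: s_def coeff_monom_mult coeff_eq_0 coeff_pCons split: nat.splits)
    qed
    have "frac_scale r x = ev (smult u p + smult v s)"
      by (simp add: frac_scale_def r p s_def algebra_simps)
    also have "\<dots> \<in> L n"
      using p(2) s by (intro L_I degree_add_le) (auto intro: order.trans[OF degree_smult_le])
    finally show ?thesis .
  qed
qed

text \<open>For the harder inclusion, a polynomial of degree at most n + 1 is k + x p' with deg p'
  at most n, so its value is k times 1 plus p'(\<theta>) times \<theta>, where both 1 and \<theta>
  lie in \<open>L 1\<close>.\<close>

lemma ideal_mult_L:
  assumes "n \<ge> 1"
  shows "ideal_mult (L n) (L 1) = L (Suc n)"
proof
  show "ideal_mult (L n) (L 1) \<subseteq> L (Suc n)"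
    unfolding ideal_mult_def
  proof (rule frac_mod.span_minimal)
    show "{x * y |x y. x \<in> L n \<and> y \<in> L 1} \<subseteq> L (Suc n)"
    proof clarify
      fix x y assume "x \<in> L n" "y \<in> L 1"
      then obtain p q where "x = ev p" "y = ev q" "degree p \<le> n" "degree q \<le> 1" by (auto simp: L_def)
      thus "x * y \<in> L (Suc n)"
        using L_I[of "p * q" "Suc n"] degree_mult_le[of p q] by simp
    qed
  qed (rule subspace_L, simp)
  have prod: "x * y \<in> ideal_mult (L n) (L 1)" if "x \<in> L n" "y \<in> L 1" for x y
    unfolding ideal_mult_def using that by (blast intro: frac_mod.span_base)
  have "1 \<in> L 1" "\<theta> \<in> L 1" using L_I[of 1 1] L_I[of "[:0, 1:]" 1] by simp_all
  show "L (Suc n) \<subseteq> ideal_mult (L n) (L 1)"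
  proof
    fix x assume "x \<in> L (Suc n)"
    then obtain p where p: "x = ev p" "degree p \<le> Suc n" by (auto simp: L_def)
    obtain k p' where pk: "p = pCons k p'" by (rule pCons_cases)
    have "degree p' \<le> n" using p(2) pk by (auto simp: degree_pCons_eq_if split: if_splits)
    hence "of_int k \<in> L n" "ev p' \<in> L n" using L_I[of "[:k:]" n] L_I[of p' n] by simp_all
    hence "of_int k * 1 + ev p' * \<theta> \<in> ideal_mult (L n) (L 1)"
      using prod \<open>1 \<in> L 1\<close> \<open>\<theta> \<in> L 1\<close> unfolding ideal_mult_def
      by (intro frac_mod.span_add) (simp_all only:)
    thus "x \<in> ideal_mult (L n) (L 1)" by (simp add: p(1) pk mult.commute)
  qed
qed

text \<open>Integer coefficients suffice because \<open>L 1\<close> is already closed under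
  multiplication by the order.\<close>

lemma span_one_theta: "frac_mod.span {1, \<theta>} = L 1"
proof
  show "frac_mod.span {1, \<theta>} \<subseteq> L 1"
    using L_I[of 1 1] L_I[of "[:0, 1:]" 1] by (intro frac_mod.span_minimal subspace_L) simp_all
  show "L 1 \<subseteq> frac_mod.span {1, \<theta>}"
  proof
    fix x assume "x \<in> L 1"
    then obtain p where p: "x = ev p" "degree p \<le> 1" by (auto simp: L_def)
    then obtain u v where "p = [:u, v:]" by (metis degree1_coeffs degree_eq_zeroE le_neq_implies_less less_one pCons_0_0)
    hence "x = frac_scale (of_int u) 1 + frac_scale (of_int v) \<theta>"
      by (simp add: p frac_scale_def mult.commute)
    also have "\<dots> \<in> frac_mod.span {1, \<theta>}"
      by (intro frac_mod.span_add frac_mod.span_scale frac_mod.span_base) simp_all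
    finally show "x \<in> frac_mod.span {1, \<theta>}" .
  qed
qed

text \<open>The inverse of \<open>\<langle>1, \<theta>\<rangle>\<close> is \<open>\<langle>a, a \<theta> + b\<rangle>\<close>: the products of the generators are \<open>a\<close>, \<open>a \<theta> + b\<close>,
  \<open>a \<theta>\<close> and \<open>- c\<close>, which generate the unit ideal because the form is primitive.\<close>

lemma invertible_L1: "invertible_ideal (L 1)"
proof -
  let ?R = "range (to_fract :: 'a \<Rightarrow> _)"
  let ?J = "frac_mod.span {of_int a, of_int a * \<theta> + of_int b}"
  let ?P = "ideal_mult (L 1) ?J"
  have R: "frac_mod.subspace ?R" by (simp add: range_to_fract)
  have a\<theta>: "of_int u + of_int v * (of_int a * \<theta>) \<in> ?R" for u v
    unfolding order_basis by blast
  have J_R: "?J \<subseteq> ?R"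
    using a\<theta>[of b 1] a\<theta>[of a 0] by (intro frac_mod.span_minimal R) (simp_all add: add.commute)
  have "frac_scale 1 ` ?J \<subseteq> ?R" using J_R by (simp add: frac_scale_def)
  hence J: "fractional_ideal ?J"
    unfolding fractional_ideal_def by (intro conjI exI[of _ 1]) simp_all
  \<comment> \<open>The integer a is a common denominator, since a and a \<theta> both lie in the
    order.\<close>
  have L1: "fractional_ideal (L 1)"
    unfolding fractional_ideal_def
  proof (intro conjI exI[of _ "of_int a :: 'a"])
    show "frac_mod.subspace (L 1)" by (rule subspace_L) simp
    show "(of_int a :: 'a) \<noteq> 0" using a_nonzero by (metis of_int_eq_0 to_fract_0 to_fract_of_int)
    have "frac_mod.span {1, \<theta>} \<subseteq> {x. of_int a * x \<in> ?R}"
    proof (rule frac_mod.span_minimal)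
      show "{1, \<theta>} \<subseteq> {x. of_int a * x \<in> ?R}" using a\<theta>[of a 0] a\<theta>[of 0 1] by simp
      show "frac_mod.subspace {x. of_int a * x \<in> ?R}"
        unfolding frac_mod.subspace_def
        using frac_mod.subspace_0[OF R] frac_mod.subspace_add[OF R] frac_mod.subspace_scale[OF R]
        by (auto simp: frac_scale_def distrib_left mult.left_commute[of "of_int a"])
    qed
    thus "frac_scale (of_int a) ` L 1 \<subseteq> ?R"
      unfolding span_one_theta by (auto simp: frac_scale_def)
  qed
  have P: "?P = frac_mod.span {x * y | x y. x \<in> {1, \<theta>} \<and> y \<in> {of_int a, of_int a * \<theta> + of_int b}}"
    unfolding span_one_theta[symmetric] by (rule ideal_mult_span)
  have gens: "\<theta> * (of_int a * \<theta> + of_int b) = of_int (- c)"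
    using root by (simp add: power2_eq_square algebra_simps eq_neg_iff_add_eq_0)
  have "?P \<subseteq> ?R" unfolding P
  proof (rule frac_mod.span_minimal[OF _ R], clarify)
    fix x y :: "'a fract" assume "x \<in> {1, \<theta>}" "y \<in> {of_int a, of_int a * \<theta> + of_int b}"
    moreover have "1 * of_int a \<in> ?R" "1 * (of_int a * \<theta> + of_int b) \<in> ?R" "\<theta> * of_int a \<in> ?R"
      "\<theta> * (of_int a * \<theta> + of_int b) \<in> ?R"
      using a\<theta>[of a 0] a\<theta>[of b 1] a\<theta>[of 0 1] a\<theta>[of "- c" 0]
      by (simp_all only: gens) (simp_all add: add.commute mult.commute[of \<theta> "of_int a"])
    ultimately show "x * y \<in> ?R" by blast
  qed
  moreover have "?R \<subseteq> ?P"
  proof -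
    have sub: "frac_mod.subspace ?P" by (simp add: ideal_mult_def)
    have g: "x * y \<in> ?P" if "x \<in> {1, \<theta>}" "y \<in> {of_int a, of_int a * \<theta> + of_int b}" for x y
      unfolding P using that by (blast intro: frac_mod.span_base)
    have A: "of_int a \<in> ?P" using g[of 1 "of_int a"] by simp
    have B: "of_int b \<in> ?P"
      using frac_mod.subspace_diff[OF sub g[of 1 "of_int a * \<theta> + of_int b"] g[of \<theta> "of_int a"]]
      by (simp add: mult.commute)
    have C: "of_int c \<in> ?P"
      using frac_mod.subspace_neg[OF sub g[of \<theta> "of_int a * \<theta> + of_int b"]] by (simp add: gens)
    obtain x y' where 1: "x * a + y' * gcd b c = 1" using bezout_int[of a "gcd b c"] primitive by auto
    obtain y z where 2: "y * b + z * c = gcd b c" using bezout_int[of b c] by auto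
    have "x * a + (y' * y) * b + (y' * z) * c = 1" using 1 2 by (simp add: algebra_simps flip: 2)
    hence "of_int x * of_int a + of_int (y' * y) * of_int b + of_int (y' * z) * of_int c = (1 :: 'a fract)"
      by (metis of_int_1 of_int_add of_int_mult)
    moreover have "frac_scale (of_int x) (of_int a) + frac_scale (of_int (y' * y)) (of_int b)
        + frac_scale (of_int (y' * z)) (of_int c) \<in> ?P"
      using A B C sub by (intro frac_mod.subspace_add frac_mod.subspace_scale)
    ultimately have "1 \<in> ?P" by (simp add: frac_scale_def)
    thus ?thesis unfolding range_to_fract by (intro frac_mod.span_minimal sub) simp
  qed
  ultimately show ?thesis using L1 J unfolding invertible_ideal_def by blast
qed

text \<open>The pseudo-remainder of h by \<open>Q\<close> is linear and vanishes at \<theta>, so it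
  is zero by \<open>indep\<close>. Thus \<open>Q\<close> divides h over the rationals, and as
  \<open>Q\<close> has content 1, Gauss' lemma gives a quotient with integer coefficients.\<close>

lemma ev_eq_0_imp_dvd:
  assumes "ev h = 0"
  shows "Q dvd h"
proof -
  have Q0: "Q \<noteq> 0" using a_nonzero by (simp add: Q_def)
  obtain k p where k: "k \<noteq> 0" and kp: "smult k h = Q * p + pseudo_mod h Q"
    using pseudo_mod(1)[OF Q0] by blast
  have "degree (pseudo_mod h Q) \<le> 1"
    using pseudo_mod(2)[OF Q0, of h] by auto
  then obtain u v where r: "pseudo_mod h Q = [:u, v:]"
    by (metis degree1_coeffs degree_eq_zeroE le_neq_implies_less less_one pCons_0_0)
  have "ev (pseudo_mod h Q) = 0"
    using arg_cong[OF kp, of ev] assms by simp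
  hence "of_int u + of_int v * \<theta> = 0" by (simp add: r mult.commute)
  hence "pseudo_mod h Q = 0" using indep[of u v] by (simp add: r)
  hence "Q dvd smult k h" using kp by simp
  hence "fract_poly Q dvd smult (to_fract k) (fract_poly h)"
    using fract_poly_dvd[of Q "smult k h"] by simp
  hence "fract_poly Q dvd fract_poly h" using k by (simp add: dvd_smult_iff)
  moreover have "content Q = 1"
    using primitive by (simp add: Q_def content_def gcd.commute gcd.left_commute a_nonzero cCons_def)
  ultimately show ?thesis by (rule fract_poly_dvdD)
qed

section \<open>Powers of the ideal in the class group and the resultant criterion\<close>

interpretation G: comm_group "invertible_ideal_group :: 'a fract set monoid"
  by (rule comm_group_invertible_ideals)

lemma L1_carrier: "L 1 \<in> carrier invertible_ideal_group"
  using invertible_L1 by (simp add: invertible_ideal_group_def)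

lemma L_pow: "n \<ge> 1 \<Longrightarrow> L 1 [^]\<^bsub>invertible_ideal_group\<^esub> n = L n"
proof (induction n rule: nat_induct_at_least)
  case base
  show ?case using L1_carrier by simp
next
  case (Suc n)
  thus ?case using ideal_mult_L by (simp add: invertible_ideal_group_def)
qed

lemma L_carrier: "n \<ge> 1 \<Longrightarrow> L n \<in> carrier invertible_ideal_group"
  using L_pow[of n] G.nat_pow_closed[OF L1_carrier, of n] by simp

text \<open>Multiplying by the invertible ideal \<open>L 1\<close> turns the question whether
  \<phi>(\<theta>) generates \<open>L n\<close> over the order into the equality of
  \<open>L (Suc n)\<close> with \<phi>(\<theta>) \<open>L 1\<close>. Both sides are sets of values
  of integer polynomials of bounded degree, so the equality lifts to polynomials modulo
  \<open>Q\<close>, where \<open>resultant_sub_unit_iff\<close> applies.\<close>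

lemma L_principal_iff:
  assumes n: "n \<ge> 1"
  shows "L n \<in> principal_ideals \<longleftrightarrow> (\<exists>\<phi>. degree \<phi> \<le> n \<and> resultant_sub 2 n Q \<phi> \<in> {1, - 1})"
proof
  assume "L n \<in> principal_ideals"
  then obtain \<gamma> where \<gamma>: "L n = frac_mod.span {\<gamma>}" unfolding principal_ideals_def by blast
  have "\<gamma> \<in> L n" unfolding \<gamma> by (simp add: frac_mod.span_base)
  then obtain \<phi> where \<phi>: "\<gamma> = ev \<phi>" "degree \<phi> \<le> n" by (auto simp: L_def)
  have L: "L (Suc n) = (*) \<gamma> ` L 1"
    using ideal_mult_L[OF n] principal_times_ideal[OF subspace_L[of 1]] by (simp add: \<gamma>)
  have Q0: "Q \<noteq> 0" using a_nonzero by (simp add: Q_def)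
  have "\<exists>A B. degree A < n \<and> degree B < 2 \<and> h = A * Q + B * \<phi>" if h: "degree h < 2 + n" for h
  proof -
    have "ev h \<in> L (Suc n)" using h by (intro L_I) simp
    then obtain B where B: "ev h = ev \<phi> * ev B" "degree B \<le> 1" unfolding L by (auto simp: L_def \<phi>)
    have "Q dvd h - B * \<phi>" by (rule ev_eq_0_imp_dvd) (simp add: B)
    then obtain A where A: "h - B * \<phi> = Q * A" by (elim dvdE)
    \<comment> \<open>Because \<open>Q\<close> has exact degree 2, the quotient has degree at most n
      - 1; if it is zero, its degree 0 is below n as n is at least 1.\<close>
    have "degree (h - B * \<phi>) \<le> Suc n"
      using h B(2) \<phi>(2) degree_mult_le[of B \<phi>] by (intro degree_diff_le) auto
    hence "degree A < n"
      using n unfolding A by (cases "A = 0") (simp_all add: degree_mult_eq Q0)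
    thus ?thesis using A B(2) by (intro exI[of _ A] exI[of _ B]) (simp add: algebra_simps)
  qed
  hence "resultant_sub 2 n Q \<phi> \<in> {1, - 1}"
    using resultant_sub_unit_iff[of Q 2 \<phi> n] \<phi>(2) n by simp
  thus "\<exists>\<phi>. degree \<phi> \<le> n \<and> resultant_sub 2 n Q \<phi> \<in> {1, - 1}" using \<phi>(2) by blast
next
  assume "\<exists>\<phi>. degree \<phi> \<le> n \<and> resultant_sub 2 n Q \<phi> \<in> {1, - 1}"
  then obtain \<phi> where \<phi>: "degree \<phi> \<le> n" "resultant_sub 2 n Q \<phi> \<in> {1, - 1}" by blast
  have surj: "\<exists>A B. degree A < n \<and> degree B < 2 \<and> h = A * Q + B * \<phi>" if "degree h < 2 + n" for h
    using resultant_sub_unit_iff[of Q 2 \<phi> n] \<phi> n that by simp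
  have fac: "\<exists>B. degree B \<le> 1 \<and> ev h = ev \<phi> * ev B" if h: "degree h \<le> Suc n" for h
  proof -
    obtain A B where AB: "degree B < 2" "h = A * Q + B * \<phi>" using surj[of h] h by auto
    have "ev h = ev \<phi> * ev B" by (simp add: AB(2))
    thus ?thesis using AB(1) by (intro exI[of _ B]) auto
  qed
  have L: "L (Suc n) = (*) (ev \<phi>) ` L 1"
  proof
    show "L (Suc n) \<subseteq> (*) (ev \<phi>) ` L 1" using fac by (fastforce simp: L_def)
    show "(*) (ev \<phi>) ` L 1 \<subseteq> L (Suc n)"
    proof
      fix x assume "x \<in> (*) (ev \<phi>) ` L 1"
      then obtain B where "x = ev (\<phi> * B)" "degree B \<le> 1" by (auto simp: L_def)
      thus "x \<in> L (Suc n)"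
        using degree_mult_le[of \<phi> B] \<phi>(1) L_I[of "\<phi> * B" "Suc n"] by (simp del: ev_simps)
    qed
  qed
  \<comment> \<open>The constant 1 is a value of the required kind, hence a multiple of
    \<phi>(\<theta>).\<close>
  have "ev \<phi> \<noteq> 0" using fac[of 1] by auto
  hence P: "frac_mod.span {ev \<phi>} \<in> principal_ideals" unfolding principal_ideals_def by blast
  hence "frac_mod.span {ev \<phi>} \<in> carrier invertible_ideal_group"
    using normal_principal_ideals normal_imp_subgroup subgroup.subset by blast
  \<comment> \<open>Both products equal \<open>L (Suc n)\<close>; the factor \<open>L 1\<close>
    cancels in the group of invertible ideals.\<close>
  moreover have "L n \<otimes>\<^bsub>invertible_ideal_group\<^esub> L 1 = frac_mod.span {ev \<phi>} \<otimes>\<^bsub>invertible_ideal_group\<^esub> L 1"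
    using ideal_mult_L[OF n] principal_times_ideal[OF subspace_L[of 1], of "ev \<phi>"] L
    by (simp add: invertible_ideal_group_def)
  ultimately have "L n = frac_mod.span {ev \<phi>}" using L_carrier[OF n] L1_carrier by simp
  thus "L n \<in> principal_ideals" using P by simp
qed

text \<open>The principal factor does not affect the class, so the class of \<open>I\<close> is that
  of \<open>L 1\<close> and its n-th power is that of \<open>L n\<close>, which is trivial exactly
  if \<open>L n\<close> is principal.\<close>

lemma torsion_iff:
  assumes n: "n \<ge> 1" and \<beta>: "\<beta> \<noteq> 0"
  defines "I \<equiv> ideal_mult (frac_mod.span {\<beta>}) (L 1)"
  shows "invertible_ideal I"
    and "ideal_class I \<in> torsion class_group n \<longleftrightarrow> L n \<in> principal_ideals"
proof -
  let ?G = "invertible_ideal_group :: 'a fract set monoid"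
  interpret N: normal principal_ideals ?G by (rule normal_principal_ideals)
  have P: "frac_mod.span {\<beta>} \<in> principal_ideals" using \<beta> unfolding principal_ideals_def by blast
  hence Pc: "frac_mod.span {\<beta>} \<in> carrier ?G" using N.subset by blast
  have I: "I = frac_mod.span {\<beta>} \<otimes>\<^bsub>?G\<^esub> L 1" by (simp add: I_def invertible_ideal_group_def)
  hence "I \<in> carrier ?G" using Pc L1_carrier by simp
  thus "invertible_ideal I" by (simp add: invertible_ideal_group_def)
  have "principal_ideals #>\<^bsub>?G\<^esub> I = principal_ideals #>\<^bsub>?G\<^esub> frac_mod.span {\<beta>} #>\<^bsub>?G\<^esub> L 1"
    unfolding I using G.coset_mult_assoc[OF N.subset Pc L1_carrier] by simp
  also have "principal_ideals #>\<^bsub>?G\<^esub> frac_mod.span {\<beta>} = principal_ideals"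
    using G.coset_join2[OF Pc N.subgroup_axioms P] .
  finally have cl: "ideal_class I = principal_ideals #>\<^bsub>?G\<^esub> L 1" by (simp add: ideal_class_def)
  have "ideal_class I [^]\<^bsub>class_group\<^esub> n = principal_ideals #>\<^bsub>?G\<^esub> L n"
    unfolding cl class_group_def N.FactGroup_pow[OF L1_carrier] L_pow[OF n] ..
  moreover have "ideal_class I \<in> carrier class_group"
    using L1_carrier by (auto simp: cl class_group_def FactGroup_def RCOSETS_def)
  moreover have "\<one>\<^bsub>class_group\<^esub> = (principal_ideals :: 'a fract set set)"
    by (simp add: class_group_def FactGroup_def)
  moreover have "principal_ideals #>\<^bsub>?G\<^esub> L n = principal_ideals \<longleftrightarrow> L n \<in> principal_ideals"
    using G.coset_join1[OF _ L_carrier[OF n] N.subgroup_axioms]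
      G.coset_join2[OF L_carrier[OF n] N.subgroup_axioms] by blast
  ultimately show "ideal_class I \<in> torsion class_group n \<longleftrightarrow> L n \<in> principal_ideals"
    by (simp add: torsion_def)
qed

end

section \<open>Pairs \<open>(\<alpha>, \<beta>)\<close> representing a form\<close>

lemma generator_coords:
  assumes "int_basis 1 (\<tau> :: 'a::idom)"
  obtains u v where "x = of_int u + of_int v * \<tau>"
  using int_basis_obtain[OF assms, of x] by (metis mult.right_neutral)

text \<open>With conjugates \<alpha>' and \<beta>', the norm of - \<beta> x + \<alpha> y is (-
  \<beta> x + \<alpha> y)(- \<beta>' x + \<alpha>' y). This product is M times the form, and its
  first factor vanishes at (x, y) = (\<alpha>, \<beta>). Moreover \<beta> has norm M a, which is
  nonzero.\<close>

lemma root_of_norm_identity: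
  fixes \<tau> \<alpha> \<beta> :: "'a::idom" and N :: "'a \<Rightarrow> int" and a b c M :: int
  assumes bas: "int_basis 1 \<tau>" and sq: "\<tau>\<^sup>2 = - of_int b * \<tau> - of_int (a * c)"
    and N: "\<And>u v. N (of_int u + of_int v * \<tau>) = u\<^sup>2 - b * u * v + a * c * v\<^sup>2"
    and M: "M \<noteq> 0" and a: "a \<noteq> 0"
    and id: "\<And>x y. N (- \<beta> * of_int x + \<alpha> * of_int y) = M * (a * x\<^sup>2 + b * x * y + c * y\<^sup>2)"
  shows "\<beta> \<noteq> 0" and "of_int a * \<alpha>\<^sup>2 + of_int b * \<alpha> * \<beta> + of_int c * \<beta>\<^sup>2 = 0"
proof -
  obtain u v where \<alpha>: "\<alpha> = of_int u + of_int v * \<tau>" using generator_coords[OF bas] .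
  obtain u' v' where \<beta>: "\<beta> = of_int u' + of_int v' * \<tau>" using generator_coords[OF bas] .
  have id': "(- u' * x + u * y)\<^sup>2 - b * (- u' * x + u * y) * (- v' * x + v * y) + a * c * (- v' * x + v * y)\<^sup>2
      = M * (a * x\<^sup>2 + b * x * y + c * y\<^sup>2)" for x y
  proof -
    have "- \<beta> * of_int x + \<alpha> * of_int y = of_int (- u' * x + u * y) + of_int (- v' * x + v * y) * \<tau>"
      by (simp add: \<alpha> \<beta> algebra_simps)
    thus ?thesis using id[of x y] by (simp only: N)
  qed
  \<comment> \<open>The coefficients of the two forms are compared through the values at (1, 0), (0,
    1) and (1, 1).\<close>
  have A: "u'\<^sup>2 - b * u' * v' + a * c * v'\<^sup>2 = M * a" using id'[of 1 0] by simp
  have C: "u\<^sup>2 - b * u * v + a * c * v\<^sup>2 = M * c" using id'[of 0 1] by simp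
  have B: "- (2 * u * u') + b * (u * v' + u' * v) - 2 * a * c * v * v' = M * b"
    using id'[of 1 1] A C by (simp add: power2_eq_square algebra_simps)
  show "\<beta> \<noteq> 0"
  proof
    assume "\<beta> = 0"
    hence "u' = 0 \<and> v' = 0" using int_basis_one_eq0[OF bas] \<beta> by metis
    thus False using A M a by simp
  qed
  \<comment> \<open>These are the conjugates of \<alpha> and \<beta>, as the conjugate of \<tau> is
    - b - \<tau>.\<close>
  define \<alpha>' \<beta>' where "\<alpha>' = of_int (u - b * v) - of_int v * \<tau>" and "\<beta>' = of_int (u' - b * v') - of_int v' * \<tau>"
  have "\<tau> * \<tau> = - of_int b * \<tau> - of_int a * of_int c"
    using sq by (simp add: power2_eq_square)
  hence \<tau>: "\<tau> * \<tau> = - of_int b * \<tau> - of_int a * of_int c"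
    "\<tau> * (\<tau> * x) = (- of_int b * \<tau> - of_int a * of_int c) * x" for x
    by (simp_all flip: mult.assoc)
  have A': "of_int (M * a) = \<beta> * \<beta>'" and C': "of_int (M * c) = \<alpha> * \<alpha>'"
    and B': "of_int (M * b) = - (\<alpha> * \<beta>' + \<beta> * \<alpha>')"
    unfolding A[symmetric] B[symmetric] C[symmetric] \<alpha> \<beta> \<alpha>'_def \<beta>'_def
    by (simp_all add: power2_eq_square algebra_simps \<tau>)
  have "of_int M * (of_int a * \<alpha>\<^sup>2 + of_int b * \<alpha> * \<beta> + of_int c * \<beta>\<^sup>2)
      = of_int (M * a) * \<alpha>\<^sup>2 + of_int (M * b) * (\<alpha> * \<beta>) + of_int (M * c) * \<beta>\<^sup>2"
    by (simp add: algebra_simps)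
  also have "\<dots> = 0"
    unfolding A' B' C' by (simp add: power2_eq_square algebra_simps)
  finally have "of_int M * (of_int a * \<alpha>\<^sup>2 + of_int b * \<alpha> * \<beta> + of_int c * \<beta>\<^sup>2) = 0" .
  moreover have "(of_int M :: 'a) \<noteq> 0" using int_basis_one_eq0[OF bas, of M 0] M by auto
  ultimately show "of_int a * \<alpha>\<^sup>2 + of_int b * \<alpha> * \<beta> + of_int c * \<beta>\<^sup>2 = 0" by simp
qed

text \<open>Both a \<theta> and \<tau> are roots of X^2 + b X + a c, so a \<theta> is \<tau> or its
  conjugate - b - \<tau>. In either case 1 and a \<theta> form a basis of the order.\<close>

lemma quadratic_form_root_quotient:
  fixes \<tau> \<alpha> \<beta> :: "'a::idom" and a b c :: int
  assumes bas: "int_basis 1 \<tau>" and sq: "\<tau>\<^sup>2 = - of_int b * \<tau> - of_int (a * c)"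
    and prim: "gcd a (gcd b c) = 1" and a: "a \<noteq> 0" and \<beta>: "\<beta> \<noteq> 0"
    and root: "of_int a * \<alpha>\<^sup>2 + of_int b * \<alpha> * \<beta> + of_int c * \<beta>\<^sup>2 = 0"
  shows "quadratic_form_root a b c (to_fract \<alpha> / to_fract \<beta>)"
proof -
  let ?\<theta> = "to_fract \<alpha> / to_fract \<beta>"
  have b0: "to_fract \<beta> \<noteq> 0" using \<beta> by simp
  have "to_fract (of_int a * \<alpha>\<^sup>2 + of_int b * \<alpha> * \<beta> + of_int c * \<beta>\<^sup>2) = 0" by (simp only: root to_fract_0)
  hence "of_int a * to_fract \<alpha> * to_fract \<alpha> + of_int b * to_fract \<alpha> * to_fract \<beta>
      + of_int c * to_fract \<beta> * to_fract \<beta> = 0"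
    by (simp add: power2_eq_square algebra_simps)
  hence r: "of_int a * ?\<theta>\<^sup>2 + of_int b * ?\<theta> + of_int c = 0"
    using b0 by (simp add: power2_eq_square field_simps)
  have \<tau>: "\<tau> * (of_int b + \<tau>) = - of_int (a * c)"
  proof -
    have "\<tau> * (of_int b + \<tau>) = of_int b * \<tau> + \<tau>\<^sup>2" by (simp add: power2_eq_square algebra_simps)
    thus ?thesis by (simp add: sq)
  qed
  \<comment> \<open>Over the order, a times the form splits into linear factors because \<tau> (b +
    \<tau>) = - a c.\<close>
  have "(of_int a * \<alpha> - \<tau> * \<beta>) * (of_int a * \<alpha> + (of_int b + \<tau>) * \<beta>)
      = of_int a * (of_int a * \<alpha>\<^sup>2 + of_int b * \<alpha> * \<beta>) - \<tau> * (of_int b + \<tau>) * \<beta>\<^sup>2"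
    by (simp add: power2_eq_square algebra_simps)
  also have "\<dots> = of_int a * (of_int a * \<alpha>\<^sup>2 + of_int b * \<alpha> * \<beta> + of_int c * \<beta>\<^sup>2)"
    unfolding \<tau> by (simp add: algebra_simps)
  also have "\<dots> = 0" unfolding root by simp
  finally have "of_int a * \<alpha> = \<tau> * \<beta> \<or> of_int a * \<alpha> = - ((of_int b + \<tau>) * \<beta>)"
    by (auto simp: eq_neg_iff_add_eq_0)
  hence "to_fract (of_int a * \<alpha>) = to_fract (\<tau> * \<beta>) \<or> to_fract (of_int a * \<alpha>) = to_fract (- ((of_int b + \<tau>) * \<beta>))"
    by metis
  hence "of_int a * ?\<theta> = to_fract \<tau> \<or> of_int a * ?\<theta> = - (of_int b + to_fract \<tau>)"
    using b0 by (auto simp: field_simps eq_neg_iff_add_eq_0)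
  hence "of_int a * ?\<theta> = to_fract \<tau> \<or> of_int a * ?\<theta> = - of_int b - to_fract \<tau>" by simp
  \<comment> \<open>A common shape for the two cases: (e, f) is (1, 0) for \<tau> and (- 1, - b) for
    its conjugate.\<close>
  then obtain e f where e: "e \<in> {1, - 1 :: int}" and af: "of_int a * ?\<theta> = of_int f + of_int e * to_fract \<tau>"
  proof
    assume "of_int a * ?\<theta> = to_fract \<tau>"
    thus ?thesis using that[of 1 0] by simp
  next
    assume "of_int a * ?\<theta> = - of_int b - to_fract \<tau>"
    thus ?thesis using that[of "-1" "-b"] by simp
  qed
  have comb: "of_int u + of_int v * (of_int a * ?\<theta>) = to_fract (of_int (u + v * f) + of_int (v * e) * \<tau>)" for u v
    unfolding af by (simp add: algebra_simps)
  have ee: "e * e = 1" using e by auto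
  have "to_fract x \<in> {of_int u + of_int v * (of_int a * ?\<theta>) | u v. True}" for x
  proof -
    obtain u v where "x = of_int u + of_int v * \<tau>" using generator_coords[OF bas] .
    hence "to_fract x = of_int (u - v * e * f) + of_int (v * e) * (of_int a * ?\<theta>)"
      unfolding comb by (simp add: mult.assoc ee)
    thus ?thesis by blast
  qed
  hence "range to_fract = {of_int u + of_int v * (of_int a * ?\<theta>) | u v. True}"
    unfolding comb by blast
  moreover have "u = 0 \<and> v = 0" if uv: "of_int u + of_int v * ?\<theta> = 0" for u v
  proof -
    have "of_int (a * u) + of_int v * (of_int a * ?\<theta>) = of_int a * (of_int u + of_int v * ?\<theta>)"
      by (simp add: algebra_simps)
    hence "to_fract (of_int (a * u + v * f) + of_int (v * e) * \<tau>) = 0" unfolding uv comb by simp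
    hence "of_int (a * u + v * f) + of_int (v * e) * \<tau> = 0" by (simp only: to_fract_eq_0_iff)
    hence "a * u + v * f = 0 \<and> v * e = 0" by (rule int_basis_one_eq0[OF bas])
    thus ?thesis using a e by auto
  qed
  ultimately show ?thesis using r prim by unfold_locales
qed

section \<open>The ideal generated by \<alpha> and \<beta>, its index, and the existence of a pair
  for every form\<close>

lemma ideal_gen2_eq_mult:
  fixes \<alpha> \<beta> :: "'a::idom"
  assumes "\<beta> \<noteq> 0"
  shows "to_fract ` ideal_gen2 \<alpha> \<beta>
    = ideal_mult (frac_mod.span {to_fract \<beta>}) (frac_mod.span {1, to_fract \<alpha> / to_fract \<beta>})"
proof -
  let ?\<theta> = "to_fract \<alpha> / to_fract \<beta>"
  have "frac_mod.span {1, ?\<theta>} = {to_fract s + to_fract r * ?\<theta> | r s. True}"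
    by (auto simp: frac_mod.span_insert frac_mod.span_singleton frac_scale_def algebra_simps)
  moreover have "ideal_mult (frac_mod.span {to_fract \<beta>}) (frac_mod.span {1, ?\<theta>})
      = (*) (to_fract \<beta>) ` frac_mod.span {1, ?\<theta>}"
    by (rule principal_times_ideal) simp
  ultimately have "ideal_mult (frac_mod.span {to_fract \<beta>}) (frac_mod.span {1, ?\<theta>})
      = (*) (to_fract \<beta>) ` {to_fract s + to_fract r * ?\<theta> | r s. True}"
    by (simp only:)
  moreover have "to_fract \<beta> * (to_fract s + to_fract r * ?\<theta>) = to_fract (r * \<alpha> + s * \<beta>)" for r s
    using assms by (simp add: field_simps)
  moreover have "to_fract ` ideal_gen2 \<alpha> \<beta> = {to_fract (r * \<alpha> + s * \<beta>) | r s. True}"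
    unfolding ideal_gen2_def by blast
  moreover have "(*) (to_fract \<beta>) ` {to_fract s + to_fract r * ?\<theta> | r s. True}
      = {to_fract \<beta> * (to_fract s + to_fract r * ?\<theta>) | r s. True}" by blast
  ultimately show ?thesis by (simp only:)
qed

text \<open>As \<tau>^2 = - b \<tau> - a c, every multiple of \<tau> has a constant coordinate
  divisible by a. The ideal therefore consists of all u + v \<tau> with a dividing u, and the
  residue of u modulo a determines the class.\<close>

lemma ideal_norm_gen2:
  fixes \<tau> :: "'a::idom" and a b c :: int
  assumes bas: "int_basis 1 \<tau>" and sq: "\<tau>\<^sup>2 = - of_int b * \<tau> - of_int (a * c)" and a: "a \<noteq> 0"
  shows "ideal_norm (ideal_gen2 \<tau> (of_int a)) = nat \<bar>a\<bar>"
proof -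
  let ?I = "ideal_gen2 \<tau> (of_int a)"
  let ?r = "{(x, y). x - y \<in> ?I}"
  have I: "of_int u + of_int v * \<tau> \<in> ?I \<longleftrightarrow> a dvd u" for u v
  proof
    assume "of_int u + of_int v * \<tau> \<in> ?I"
    then obtain r s where rs: "of_int u + of_int v * \<tau> = r * \<tau> + s * of_int a" by (auto simp: ideal_gen2_def)
    obtain x y where r: "r = of_int x + of_int y * \<tau>" using generator_coords[OF bas] .
    obtain z w where s: "s = of_int z + of_int w * \<tau>" using generator_coords[OF bas] .
    have "r * \<tau> + s * of_int a = of_int x * \<tau> + of_int y * \<tau>\<^sup>2 + of_int (a * z) + of_int (a * w) * \<tau>"
      by (simp add: r s power2_eq_square algebra_simps)
    also have "\<dots> = of_int (a * z - a * c * y) * 1 + of_int (x - b * y + a * w) * \<tau>"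
      unfolding sq by (simp add: algebra_simps)
    finally have "of_int u * 1 + of_int v * \<tau> = of_int (a * z - a * c * y) * 1 + of_int (x - b * y + a * w) * \<tau>"
      using rs by simp
    hence "u = a * z - a * c * y" using int_basis_unique[OF bas] by blast
    hence "u = a * (z - c * y)" by (simp add: algebra_simps)
    thus "a dvd u" by simp
  next
    assume "a dvd u"
    then obtain k where "u = a * k" by blast
    hence "of_int u + of_int v * \<tau> = of_int v * \<tau> + of_int k * of_int a" by (simp add: ac_simps)
    thus "of_int u + of_int v * \<tau> \<in> ?I" unfolding ideal_gen2_def by blast
  qed
  have cl: "?r `` {of_int u + of_int v * \<tau>} = {of_int x + of_int y * \<tau> | x y. a dvd u - x}" for u v
  proof (intro equalityI subsetI)
    fix z assume z: "z \<in> ?r `` {of_int u + of_int v * \<tau>}"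
    obtain x y where xy: "z = of_int x + of_int y * \<tau>" using generator_coords[OF bas] .
    have "of_int (u - x) + of_int (v - y) * \<tau> \<in> ?I" using z by (simp add: xy algebra_simps)
    thus "z \<in> {of_int x + of_int y * \<tau> | x y. a dvd u - x}" unfolding I xy by blast
  next
    fix z assume "z \<in> {of_int x + of_int y * \<tau> | x y. a dvd u - x}"
    then obtain x y where xy: "z = of_int x + of_int y * \<tau>" "a dvd u - x" by blast
    hence "of_int (u - x) + of_int (v - y) * \<tau> \<in> ?I" unfolding I by simp
    thus "z \<in> ?r `` {of_int u + of_int v * \<tau>}" by (simp add: xy algebra_simps)
  qed
  \<comment> \<open>\<open>K k\<close> is the residue class of the integer k; the classes for 0 up
    to |a| - 1 form a complete system without repetition.\<close>
  define K where "K k = {of_int x + of_int y * \<tau> | x y. a dvd k - x}" for k :: int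
  have mem_K: "of_int x + of_int y * \<tau> \<in> K k \<longleftrightarrow> a dvd k - x" for x y k
  proof
    assume "of_int x + of_int y * \<tau> \<in> K k"
    then obtain x' y' where "of_int x * 1 + of_int y * \<tau> = of_int x' * 1 + of_int y' * \<tau>" "a dvd k - x'"
      by (auto simp: K_def)
    thus "a dvd k - x" using int_basis_unique[OF bas] by blast
  qed (auto simp: K_def)
  have "UNIV // ?r = K ` {0..<\<bar>a\<bar>}"
  proof (intro equalityI subsetI)
    fix X assume "X \<in> UNIV // ?r"
    then obtain z where "X = ?r `` {z}" by (auto simp: quotient_def)
    moreover obtain u v where "z = of_int u + of_int v * \<tau>" using generator_coords[OF bas] .
    ultimately have X: "X = K u" using cl by (simp add: K_def)
    have "a dvd u - u mod \<bar>a\<bar>" by (metis abs_dvd_iff dvd_minus_mod)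
    hence "a dvd u - x \<longleftrightarrow> a dvd u mod \<bar>a\<bar> - x" for x
      using dvd_diff_right_iff[of a "u - u mod \<bar>a\<bar>" "u - x"]
        dvd_add_right_iff[of a "u - u mod \<bar>a\<bar>" "u mod \<bar>a\<bar> - x"] by simp
    hence "X = K (u mod \<bar>a\<bar>)" unfolding X K_def by simp
    thus "X \<in> K ` {0..<\<bar>a\<bar>}" using a by (intro image_eqI[of _ _ "u mod \<bar>a\<bar>"]) simp_all
  next
    fix X assume "X \<in> K ` {0..<\<bar>a\<bar>}"
    then obtain k where "X = K k" by blast
    hence "X = ?r `` {of_int k + of_int 0 * \<tau>}" unfolding cl K_def .
    thus "X \<in> UNIV // ?r" by (simp only: quotientI UNIV_I)
  qed
  moreover have "inj_on K {0..<\<bar>a\<bar>}"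
  proof (rule inj_onI)
    fix k l assume kl: "k \<in> {0..<\<bar>a\<bar>}" "l \<in> {0..<\<bar>a\<bar>}" "K k = K l"
    have "of_int k + of_int 0 * \<tau> \<in> K l" using mem_K[of k 0 k] kl(3) by simp
    hence "\<bar>a\<bar> dvd l - k" unfolding mem_K by simp
    hence "l mod \<bar>a\<bar> = k mod \<bar>a\<bar>" by (simp add: mod_eq_dvd_iff)
    thus "k = l" using kl(1,2) by simp
  qed
  ultimately show ?thesis by (simp add: ideal_norm_def card_image)
qed

text \<open>The pair (\<tau>, a) works: the norm of - a x + \<tau> y is a^2 x^2 + a b x y + a c y^2.
  The factor is a, whereas the index is |a|, so the sign remains to be dealt with.\<close>

lemma norm_identity_leading_coeff:
  fixes \<omega>\<^sub>1 \<omega>\<^sub>2 :: "'a::idom" and a b c :: int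
  assumes bas: "int_basis \<omega>\<^sub>1 \<omega>\<^sub>2" and disc: "discriminant \<omega>\<^sub>1 \<omega>\<^sub>2 = b\<^sup>2 - 4 * a * c" and a: "a \<noteq> 0"
  obtains \<alpha> \<beta> where "ideal_norm (ideal_gen2 \<alpha> \<beta>) = nat \<bar>a\<bar>"
    "\<And>x y. norm_int \<omega>\<^sub>1 \<omega>\<^sub>2 (- \<beta> * of_int x + \<alpha> * of_int y) = a * (a * x\<^sup>2 + b * x * y + c * y\<^sup>2)"
proof -
  obtain \<tau> where \<tau>: "int_basis 1 \<tau>" "\<tau>\<^sup>2 = - of_int b * \<tau> - of_int (a * c)"
    "\<And>u v. norm_int \<omega>\<^sub>1 \<omega>\<^sub>2 (of_int u + of_int v * \<tau>) = u\<^sup>2 - b * u * v + a * c * v\<^sup>2"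
    using order_generator_exists[OF bas disc] by blast
  have "norm_int \<omega>\<^sub>1 \<omega>\<^sub>2 (- of_int a * of_int x + \<tau> * of_int y) = a * (a * x\<^sup>2 + b * x * y + c * y\<^sup>2)" for x y
  proof -
    have "- of_int a * of_int x + \<tau> * of_int y = of_int (- a * x) + of_int y * \<tau>" by (simp add: mult.commute)
    thus ?thesis by (simp only: \<tau>(3)) (simp add: power2_eq_square algebra_simps)
  qed
  thus ?thesis using that ideal_norm_gen2[OF \<tau>(1,2) a] by blast
qed

text \<open>For fixed y and a < 0 the form is largest where 2 a x + b y = 0, and at (- b, 2 a) its
  value is - a (b^2 - 4 a c) > 0. Dividing by the gcd keeps the sign and makes the vector primitive,
  so Bezout completes it to a matrix of determinant 1.\<close>

lemma indefinite_represents_positive: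
  fixes a b c :: int
  assumes "a < 0" "b\<^sup>2 - 4 * a * c > 0"
  obtains x y z w where "x * w - y * z = 1" "a * x\<^sup>2 + b * x * y + c * y\<^sup>2 > 0"
proof -
  define g where "g = gcd (- b) (2 * a)"
  have g: "g \<noteq> 0" using assms by (simp add: g_def)
  obtain x y where xy: "- b = g * x" "2 * a = g * y" unfolding g_def by (meson dvdE gcd_dvd1 gcd_dvd2)
  have "gcd x y = 1"
  proof -
    have "g = gcd (g * x) (g * y)" unfolding xy[symmetric] by (rule g_def)
    also have "\<dots> = \<bar>g\<bar> * gcd x y" by (simp add: gcd_mult_left abs_mult)
    also have "\<bar>g\<bar> = g" by (simp add: g_def)
    finally show ?thesis using g by simp
  qed
  then obtain w z' where "w * x + z' * y = 1" using bezout_int[of x y] by auto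
  hence 1: "x * w - y * (- z') = 1" by (simp add: algebra_simps)
  have "g\<^sup>2 * (a * x\<^sup>2 + b * x * y + c * y\<^sup>2) = a * (g * x)\<^sup>2 + b * (g * x) * (g * y) + c * (g * y)\<^sup>2"
    by (simp add: power2_eq_square algebra_simps)
  also have "\<dots> = - a * (b\<^sup>2 - 4 * a * c)"
    unfolding xy[symmetric] by (simp add: power2_eq_square algebra_simps)
  also have "\<dots> > 0" using assms by (intro mult_pos_pos) simp_all
  finally have "a * x\<^sup>2 + b * x * y + c * y\<^sup>2 > 0" using g by (simp add: zero_less_mult_iff)
  thus ?thesis using that 1 by blast
qed

text \<open>For an indefinite form with negative \<open>a\<close>, a change of variables in \<open>SL\<^sub>2(\<int>)\<close> makes the
  leading coefficient positive; it changes the generators of the ideal, but not the ideal.\<close>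

lemma norm_identity_exists:
  fixes \<omega>\<^sub>1 \<omega>\<^sub>2 :: "'a::idom" and a b c :: int
  assumes bas: "int_basis \<omega>\<^sub>1 \<omega>\<^sub>2" and disc: "discriminant \<omega>\<^sub>1 \<omega>\<^sub>2 = b\<^sup>2 - 4 * a * c" and a: "a \<noteq> 0"
    and d: "b\<^sup>2 - 4 * a * c \<noteq> 0"
  obtains \<alpha> \<beta> where "ideal_norm (ideal_gen2 \<alpha> \<beta>) \<noteq> 0"
    "\<And>x y. norm_int \<omega>\<^sub>1 \<omega>\<^sub>2 (- \<beta> * of_int x + \<alpha> * of_int y)
      = int (ideal_norm (ideal_gen2 \<alpha> \<beta>)) * (form_sign a b c * (a * x\<^sup>2 + b * x * y + c * y\<^sup>2))"
proof (cases "b\<^sup>2 - 4 * a * c > 0 \<and> a < 0")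
  case False
  obtain \<alpha> \<beta> where ab: "ideal_norm (ideal_gen2 \<alpha> \<beta>) = nat \<bar>a\<bar>"
    "\<And>x y. norm_int \<omega>\<^sub>1 \<omega>\<^sub>2 (- \<beta> * of_int x + \<alpha> * of_int y) = a * (a * x\<^sup>2 + b * x * y + c * y\<^sup>2)"
    using norm_identity_leading_coeff[OF bas disc a] by blast
  \<comment> \<open>In this case either a > 0 and the sign is 1, or the form is negative definite
    and the sign is - 1.\<close>
  have "int (nat \<bar>a\<bar>) * form_sign a b c = a" using False a d by (auto simp: form_sign_def)
  thus ?thesis using that[of \<alpha> \<beta>] ab a by (simp flip: mult.assoc)
next
  case True
  obtain x0 y0 z w where det: "x0 * w - y0 * z = 1" and pos: "a * x0\<^sup>2 + b * x0 * y0 + c * y0\<^sup>2 > 0"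
    using True by (elim conjE indefinite_represents_positive)
  \<comment> \<open>These are the coefficients of the form after substituting (x0 X + z Y, y0 X + w
    Y) for (x, y).\<close>
  define a' b' c' where "a' = a * x0\<^sup>2 + b * x0 * y0 + c * y0\<^sup>2"
    and "b' = 2 * a * x0 * z + b * (x0 * w + y0 * z) + 2 * c * y0 * w"
    and "c' = a * z\<^sup>2 + b * z * w + c * w\<^sup>2"
  have "b'\<^sup>2 - 4 * a' * c' = (b\<^sup>2 - 4 * a * c) * (x0 * w - y0 * z)\<^sup>2"
    unfolding a'_def b'_def c'_def by Groebner_Basis.algebra
  hence disc': "discriminant \<omega>\<^sub>1 \<omega>\<^sub>2 = b'\<^sup>2 - 4 * a' * c'" by (simp add: det disc)
  have "a' \<noteq> 0" using pos by (simp add: a'_def)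
  obtain \<alpha>' \<beta>' where ab: "ideal_norm (ideal_gen2 \<alpha>' \<beta>') = nat \<bar>a'\<bar>"
    "\<And>x y. norm_int \<omega>\<^sub>1 \<omega>\<^sub>2 (- \<beta>' * of_int x + \<alpha>' * of_int y) = a' * (a' * x\<^sup>2 + b' * x * y + c' * y\<^sup>2)"
    using norm_identity_leading_coeff[OF bas disc' \<open>a' \<noteq> 0\<close>] by blast
  \<comment> \<open>The pair is transformed so that - \<beta> x + \<alpha> y becomes - \<beta>' X +
    \<alpha>' Y with X = w x - z y and Y = x0 y - y0 x, the inverse substitution.\<close>
  define \<alpha> \<beta> where "\<alpha> = of_int z * \<beta>' + of_int x0 * \<alpha>'" and "\<beta> = of_int w * \<beta>' + of_int y0 * \<alpha>'"
  have det': "of_int x0 * of_int w - of_int y0 * of_int z = (1 :: 'a)"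
    by (metis det of_int_1 of_int_diff of_int_mult)
  have "ideal_gen2 \<alpha> \<beta> = ideal_gen2 \<alpha>' \<beta>'"
  proof (intro equalityI subsetI)
    fix t assume "t \<in> ideal_gen2 \<alpha> \<beta>"
    then obtain r s where "t = r * \<alpha> + s * \<beta>" by (auto simp: ideal_gen2_def)
    hence "t = (r * of_int x0 + s * of_int y0) * \<alpha>' + (r * of_int z + s * of_int w) * \<beta>'"
      by (simp add: \<alpha>_def \<beta>_def algebra_simps)
    thus "t \<in> ideal_gen2 \<alpha>' \<beta>'" unfolding ideal_gen2_def by blast
  next
    fix t assume "t \<in> ideal_gen2 \<alpha>' \<beta>'"
    then obtain r s where "t = r * \<alpha>' + s * \<beta>'" by (auto simp: ideal_gen2_def)
    hence "t = (of_int x0 * of_int w - of_int y0 * of_int z) * (r * \<alpha>' + s * \<beta>')" by (simp add: det')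
    also have "\<dots> = (r * of_int w - s * of_int y0) * \<alpha> + (s * of_int x0 - r * of_int z) * \<beta>"
      by (simp add: \<alpha>_def \<beta>_def algebra_simps)
    finally show "t \<in> ideal_gen2 \<alpha> \<beta>" unfolding ideal_gen2_def by blast
  qed
  hence n: "int (ideal_norm (ideal_gen2 \<alpha> \<beta>)) = a'" using ab(1) pos by (simp add: a'_def)
  have subst: "a' * X\<^sup>2 + b' * X * Y + c' * Y\<^sup>2
      = a * (x0 * X + z * Y)\<^sup>2 + b * (x0 * X + z * Y) * (y0 * X + w * Y) + c * (y0 * X + w * Y)\<^sup>2" for X Y
    unfolding a'_def b'_def c'_def by Groebner_Basis.algebra
  have "norm_int \<omega>\<^sub>1 \<omega>\<^sub>2 (- \<beta> * of_int x + \<alpha> * of_int y) = a' * (a * x\<^sup>2 + b * x * y + c * y\<^sup>2)" for x y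
  proof -
    let ?x = "w * x - z * y" and ?y = "x0 * y - y0 * x"
    have "- \<beta> * of_int x + \<alpha> * of_int y = - \<beta>' * of_int ?x + \<alpha>' * of_int ?y"
      by (simp add: \<alpha>_def \<beta>_def algebra_simps)
    moreover have "x0 * ?x + z * ?y = (x0 * w - y0 * z) * x" "y0 * ?x + w * ?y = (x0 * w - y0 * z) * y"
      by (simp_all add: algebra_simps)
    ultimately show ?thesis using ab(2)[of ?x ?y] subst[of ?x ?y] by (simp only: det mult_1)
  qed
  moreover have "form_sign a b c = 1" using True by (simp add: form_sign_def)
  moreover have "ideal_norm (ideal_gen2 \<alpha> \<beta>) \<noteq> 0" using n pos a'_def by auto
  ultimately show ?thesis using that[of \<alpha> \<beta>] n by simp
qed

section \<open>Torsion classes and unit resultants\<close>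

theorem theorem2p1:
  fixes \<omega>\<^sub>1 \<omega>\<^sub>2 :: "'a::idom" and n :: nat and a b c d :: int
  assumes "n \<ge> 1"
    and "int_basis \<omega>\<^sub>1 \<omega>\<^sub>2"
    and "discriminant \<omega>\<^sub>1 \<omega>\<^sub>2 = d"
    and "b\<^sup>2 - 4 * a * c = d"
    and "gcd a (gcd b c) = 1"
  shows "(\<exists>C \<in> torsion class_group n. corresponds_to \<omega>\<^sub>1 \<omega>\<^sub>2 a b c C) \<longleftrightarrow>
         (\<exists>t :: nat \<Rightarrow> int. form_resultant a b c n t \<in> {1, - 1})"
proof -
  note n = assms(1) and bas = assms(2) and prim = assms(5)
  have disc: "discriminant \<omega>\<^sub>1 \<omega>\<^sub>2 = b\<^sup>2 - 4 * a * c" using assms by simp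
  obtain \<tau> where \<tau>: "int_basis 1 \<tau>" "\<tau>\<^sup>2 = - of_int b * \<tau> - of_int (a * c)"
    "\<And>u v. norm_int \<omega>\<^sub>1 \<omega>\<^sub>2 (of_int u + of_int v * \<tau>) = u\<^sup>2 - b * u * v + a * c * v\<^sup>2"
    using order_generator_exists[OF bas disc] by blast
  have a: "a \<noteq> 0"
  proof
    assume "a = 0"
    hence "\<tau> * (of_int b + \<tau>) = 0" using \<tau>(2) by (simp add: power2_eq_square algebra_simps)
    hence "of_int 0 + of_int 1 * \<tau> = 0 \<or> of_int b + of_int 1 * \<tau> = 0" by simp
    thus False using int_basis_one_eq0[OF \<tau>(1)] by (metis one_neq_zero)
  qed
  \<comment> \<open>The square of b + 2 \<tau> is the discriminant; if it were 0, then b + 2 \<tau>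
    = 0 would contradict the independence of 1 and \<tau>.\<close>
  have d: "b\<^sup>2 - 4 * a * c \<noteq> 0"
  proof
    assume "b\<^sup>2 - 4 * a * c = 0"
    hence "(of_int (b\<^sup>2 - 4 * a * c) :: 'a) = 0" by simp
    moreover have "(of_int b + of_int 2 * \<tau>)\<^sup>2 = 4 * \<tau>\<^sup>2 + 4 * of_int b * \<tau> + (of_int b)\<^sup>2"
      by (simp add: power2_eq_square algebra_simps)
    ultimately have "(of_int b + of_int 2 * \<tau>)\<^sup>2 = 0" unfolding \<tau>(2) by (simp add: algebra_simps)
    thus False using int_basis_one_eq0[OF \<tau>(1), of b 2] by simp
  qed
  let ?t = "\<exists>t :: nat \<Rightarrow> int. form_resultant a b c n t \<in> {1, - 1}"
  have res: "?t \<longleftrightarrow> (\<exists>\<phi>. degree \<phi> \<le> n \<and> resultant_sub 2 n [:c, b, a:] \<phi> \<in> {1, - 1})"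
  proof
    assume ?t
    then obtain t where "resultant_sub 2 n [:c, b, a:] (\<Sum>i\<le>n. monom (t i) i) \<in> {1, - 1}"
      unfolding form_resultant_def by blast
    moreover have "degree (\<Sum>i\<le>n. monom (t i) i) \<le> n"
      by (rule degree_sum_le) (auto intro: order.trans[OF degree_monom_le])
    ultimately show "\<exists>\<phi>. degree \<phi> \<le> n \<and> resultant_sub 2 n [:c, b, a:] \<phi> \<in> {1, - 1}" by blast
  next
    assume "\<exists>\<phi>. degree \<phi> \<le> n \<and> resultant_sub 2 n [:c, b, a:] \<phi> \<in> {1, - 1}"
    then obtain \<phi> where "degree \<phi> \<le> n" "resultant_sub 2 n [:c, b, a:] \<phi> \<in> {1, - 1}" by blast
    thus ?t using poly_as_sum_of_monoms'[of \<phi> n]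
      by (intro exI[of _ "coeff \<phi>"]) (simp add: form_resultant_def)
  qed
  \<comment> \<open>Any nonzero factor M is allowed, so that M can absorb both the ideal norm and
    the sign of the form; this serves both directions.\<close>
  have key: "invertible_ideal (to_fract ` ideal_gen2 \<alpha> \<beta>) \<and>
      (ideal_class (to_fract ` ideal_gen2 \<alpha> \<beta>) \<in> torsion class_group n \<longleftrightarrow> ?t)"
    if M: "M \<noteq> 0"
      and id: "\<And>x y. norm_int \<omega>\<^sub>1 \<omega>\<^sub>2 (- \<beta> * of_int x + \<alpha> * of_int y) = M * (a * x\<^sup>2 + b * x * y + c * y\<^sup>2)"
    for M \<alpha> \<beta>
  proof -
    have \<beta>: "\<beta> \<noteq> 0" and root: "of_int a * \<alpha>\<^sup>2 + of_int b * \<alpha> * \<beta> + of_int c * \<beta>\<^sup>2 = 0"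
      using root_of_norm_identity[OF \<tau> M a id] by blast+
    interpret quadratic_form_root a b c "to_fract \<alpha> / to_fract \<beta>"
      by (rule quadratic_form_root_quotient[OF \<tau>(1,2) prim a \<beta> root])
    have I: "to_fract ` ideal_gen2 \<alpha> \<beta> = ideal_mult (frac_mod.span {to_fract \<beta>}) (L 1)"
      unfolding ideal_gen2_eq_mult[OF \<beta>] span_one_theta ..
    show ?thesis
      unfolding I res using torsion_iff[OF n, of "to_fract \<beta>"] L_principal_iff[OF n] \<beta> by (simp add: Q_def)
  qed
  show ?thesis
  proof
    assume "\<exists>C \<in> torsion class_group n. corresponds_to \<omega>\<^sub>1 \<omega>\<^sub>2 a b c C"
    then obtain \<alpha> \<beta> where tor: "ideal_class (to_fract ` ideal_gen2 \<alpha> \<beta>) \<in> torsion class_group n"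
      and id: "\<And>x y :: int. (of_int (form_sign a b c * (a * x\<^sup>2 + b * x * y + c * y\<^sup>2)) :: rat) =
           of_int (norm_int \<omega>\<^sub>1 \<omega>\<^sub>2 (- \<beta> * of_int x + \<alpha> * of_int y)) / of_nat (ideal_norm (ideal_gen2 \<alpha> \<beta>))"
      unfolding corresponds_to_def by blast
    let ?k = "ideal_norm (ideal_gen2 \<alpha> \<beta>)"
    have s: "form_sign a b c \<noteq> 0" by (simp add: form_sign_def)
    \<comment> \<open>The cardinality is 0 by convention if the index is infinite, and division by 0
      then yields 0; at (1, 0) the identity would give a = 0.\<close>
    have k: "?k \<noteq> 0"
    proof
      assume "?k = 0"
      hence "of_int (form_sign a b c * a) = (0 :: rat)" using id[of 1 0] by simp
      thus False using a s by simp
    qed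
    have clear_denom: "N = int m * s * q"
      if "(of_int (s * q) :: rat) = of_int N / of_nat m" "m \<noteq> 0" for N s q m
    proof -
      have "(of_int N :: rat) = of_nat m * of_int (s * q)" using that by (simp add: field_simps)
      hence "(of_int N :: rat) = of_int (int m * s * q)" by (simp add: mult.assoc)
      thus ?thesis by (simp only: of_int_eq_iff)
    qed
    have "norm_int \<omega>\<^sub>1 \<omega>\<^sub>2 (- \<beta> * of_int x + \<alpha> * of_int y)
        = (int ?k * form_sign a b c) * (a * x\<^sup>2 + b * x * y + c * y\<^sup>2)" for x y
      using clear_denom[OF id[of x y] k] .
    moreover have "int ?k * form_sign a b c \<noteq> 0" using k s by simp
    ultimately show ?t using key tor by blast
  next
    assume ?t
    \<comment> \<open>A unit resultant makes the class of every representing pair n-torsion; what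
      remains is that some pair represents the form with the correct sign.\<close>
    obtain \<alpha> \<beta> where k: "ideal_norm (ideal_gen2 \<alpha> \<beta>) \<noteq> 0"
      and id: "\<And>x y. norm_int \<omega>\<^sub>1 \<omega>\<^sub>2 (- \<beta> * of_int x + \<alpha> * of_int y)
      = int (ideal_norm (ideal_gen2 \<alpha> \<beta>)) * (form_sign a b c * (a * x\<^sup>2 + b * x * y + c * y\<^sup>2))"
      using norm_identity_exists[OF bas disc a d] by blast
    let ?k = "ideal_norm (ideal_gen2 \<alpha> \<beta>)"
    have "int ?k * form_sign a b c \<noteq> 0" using k by (simp add: form_sign_def)
    hence "invertible_ideal (to_fract ` ideal_gen2 \<alpha> \<beta>)"
      "ideal_class (to_fract ` ideal_gen2 \<alpha> \<beta>) \<in> torsion class_group n"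
      using key[of "int ?k * form_sign a b c" \<beta> \<alpha>] id \<open>?t\<close> by (simp_all add: mult.assoc)
    moreover have "(of_int (form_sign a b c * (a * x\<^sup>2 + b * x * y + c * y\<^sup>2)) :: rat) =
           of_int (norm_int \<omega>\<^sub>1 \<omega>\<^sub>2 (- \<beta> * of_int x + \<alpha> * of_int y)) / of_nat ?k" for x y
      unfolding id using k by simp
    ultimately show "\<exists>C \<in> torsion class_group n. corresponds_to \<omega>\<^sub>1 \<omega>\<^sub>2 a b c C"
      unfolding corresponds_to_def by blast
  qed
qed

end
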